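(* For every $n\in\{1,2,3,\dots\}\cup\{\infty\}$ there is a uniformly closed unital subalgebra $A_n$ of the disk algebra $A(\overline{\mathbb D})$ with $\operatorname{tsr}A_n=n+1$ (where $\infty+1=\infty$).
   Context: $\mathbb D=\{z\in\mathbb C:|z|<1\}$ is the open unit disk and $\overline{\mathbb D}$ its closure. The disk algebra $A(\overline{\mathbb D})$ is the algebra (with pointwise operations) of all functions $\overline{\mathbb D}\to\mathbb C$ that are continuous on $\overline{\mathbb D}$ and holomorphic on $\mathbb D$. It is equipped with the supremum norm on $\overline{\mathbb D}$; "uniformly closed" means closed with respect to this norm, and subalgebras carry the same norm. Let $A$ be a commutative unital complex Banach algebra with identity element $1$. An $n$-tuple $(f_1,\dots,f_n)\in A^n$ is called invertible if there exists $(x_1,\dots,x_n)\in A^n$ with $\sum_{j=1}^n x_jf_j=1$; the set of all invertible $n$-tuples is denoted by $U_n(A)$. The topological stable rank $\operatorname{tsr}A$ of $A$ is the least integer $n\ge 1$ for which $U_n(A)$ is dense in $A^n$ (with the product topology), or $\infty$ if no such $n$ exists. *)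

theory Defs
  imports "HOL-Complex_Analysis.Complex_Analysis" "HOL-Algebra.Subrings"
begin

section \<open>Topological stable rank\<close>

text \<open>A Banach algebra enters the topological stable rank only through its ring structure \<open>R\<close>
  and its norm topology \<open>T\<close> on \<^term>\<open>carrier R\<close>. An \<open>n\<close>-tuple is an extensional
  function on \<^term>\<open>{..<n}\<close>.\<close>

definition tuples :: "('a, 'm) ring_scheme \<Rightarrow> nat \<Rightarrow> (nat \<Rightarrow> 'a) set" where
  "tuples R n = ({..<n} \<rightarrow>\<^sub>E carrier R)"

definition invertible_tuples :: "('a, 'm) ring_scheme \<Rightarrow> nat \<Rightarrow> (nat \<Rightarrow> 'a) set" where
  "invertible_tuples R n =
     {f \<in> tuples R n. \<exists>x \<in> tuples R n. (\<Oplus>\<^bsub>R\<^esub>j\<in>{..<n}. x j \<otimes>\<^bsub>R\<^esub> f j) = \<one>\<^bsub>R\<^esub>}"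

text \<open>The infimum of the empty set in \<^typ>\<open>enat\<close> is \<open>\<infinity>\<close>.\<close>

definition tsr :: "('a, 'm) ring_scheme \<Rightarrow> 'a topology \<Rightarrow> enat" where
  "tsr R T = Inf {enat n | n. n \<ge> 1 \<and>
     product_topology (\<lambda>_. T) {..<n} closure_of invertible_tuples R n = tuples R n}"


section \<open>The disk algebra\<close>

text \<open>Functions on the closed disk are represented extensionally (\<^term>\<open>undefined\<close> outside),
  so that equality in HOL is equality on the closed disk; \<^const>\<open>cfunspace\<close> is the space of
  bounded continuous functions with the supremum distance.\<close>

definition disk_continuous :: "(complex \<Rightarrow> complex) metric" where
  "disk_continuous = cfunspace (top_of_set (cball 0 1)) euclidean_metric"

definition disk_algebra :: "(complex \<Rightarrow> complex) ring" where
  "disk_algebra =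
     \<lparr> carrier = {f \<in> mspace disk_continuous. f holomorphic_on ball 0 1},
       monoid.mult = (\<lambda>f g. \<lambda>z\<in>cball 0 1. f z * g z),
       one = (\<lambda>z\<in>cball 0 1. 1),
       zero = (\<lambda>z\<in>cball 0 1. 0),
       add = (\<lambda>f g. \<lambda>z\<in>cball 0 1. f z + g z) \<rparr>"

definition disk_metric :: "(complex \<Rightarrow> complex) metric" where
  "disk_metric = submetric disk_continuous (carrier disk_algebra)"

text \<open>\<^const>\<open>subring\<close> includes containment in the carrier and membership of the identity.\<close>

definition closed_unital_subalgebra :: "(complex \<Rightarrow> complex) set \<Rightarrow> bool" where
  "closed_unital_subalgebra A \<longleftrightarrow>
     subring A disk_algebra \<and>
     (\<forall>c. \<forall>f\<in>A. (\<lambda>z\<in>cball 0 1. c * f z) \<in> A) \<and>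
     closedin (mtopology_of disk_metric) A"

definition subalgebra_tsr :: "(complex \<Rightarrow> complex) set \<Rightarrow> enat" where
  "subalgebra_tsr A =
     tsr (disk_algebra\<lparr>carrier := A\<rparr>) (mtopology_of (submetric disk_metric A))"


subsection \<open>Basic facts\<close>

lemma carrier_disk_algebra:
  "carrier disk_algebra =
     {f \<in> extensional (cball 0 1). continuous_on (cball 0 1) f \<and> f holomorphic_on ball 0 1}"
proof -
  have "bounded (f ` cball 0 1)" if "continuous_on (cball 0 1) f" for f :: "complex \<Rightarrow> complex"
    using that by (intro compact_imp_bounded compact_continuous_image) auto
  then show ?thesis
    by (auto simp: disk_algebra_def disk_continuous_def)
qed

lemma mspace_disk_metric: "mspace disk_metric = carrier disk_algebra"
  by (auto simp: disk_metric_def disk_algebra_def)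

lemma mdist_disk_metric:
  assumes "f \<in> carrier disk_algebra" "g \<in> carrier disk_algebra"
  shows "mdist disk_metric f g = (SUP z\<in>cball 0 1. cmod (f z - g z))"
proof -
  have "f \<in> mspace disk_continuous" "g \<in> mspace disk_continuous"
    using assms by (auto simp: disk_algebra_def)
  then have "f \<in> mspace (funspace (cball 0 1) euclidean_metric)"
    "g \<in> mspace (funspace (cball 0 1) euclidean_metric)"
    using cfunspace_subset_funspace unfolding disk_continuous_def by fastforce+
  then show ?thesis
    unfolding disk_metric_def disk_continuous_def mdist_submetric
      mdist_cfunspace_eq_mdist_funspace
    by (simp add: Met_TC.fdist_def dist_norm del: mem_cball)
qed

lemma restrict_in_disk_algebra:
  assumes "continuous_on (cball 0 1) f" "f holomorphic_on ball 0 1"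
  shows "restrict f (cball 0 1) \<in> carrier disk_algebra"
proof -
  have "continuous_on (cball 0 1) (restrict f (cball 0 1))"
    using assms(1) by (rule continuous_on_eq) simp
  moreover have "restrict f (cball 0 1) holomorphic_on ball 0 1"
    using assms(2) by (rule holomorphic_transform) simp
  ultimately show ?thesis
    by (simp add: carrier_disk_algebra)
qed

lemma cring_disk_algebra: "cring disk_algebra"
proof (intro cringI abelian_groupI comm_monoidI)
  fix f assume f: "f \<in> carrier disk_algebra"
  have "(\<lambda>z\<in>cball 0 1. - f z) \<in> carrier disk_algebra"
    using f by (intro restrict_in_disk_algebra)
      (auto simp: carrier_disk_algebra intro!: continuous_intros holomorphic_intros)
  moreover have "(\<lambda>z\<in>cball 0 1. - f z) \<oplus>\<^bsub>disk_algebra\<^esub> f = \<zero>\<^bsub>disk_algebra\<^esub>"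
    by (auto simp: disk_algebra_def fun_eq_iff)
  ultimately show "\<exists>g\<in>carrier disk_algebra. g \<oplus>\<^bsub>disk_algebra\<^esub> f = \<zero>\<^bsub>disk_algebra\<^esub>"
    by blast
next
  fix f g assume fg: "f \<in> carrier disk_algebra" "g \<in> carrier disk_algebra"
  have "(\<lambda>z\<in>cball 0 1. f z + g z) \<in> carrier disk_algebra"
    using fg by (intro restrict_in_disk_algebra)
      (auto simp: carrier_disk_algebra intro!: continuous_intros holomorphic_intros)
  moreover have "(\<lambda>z\<in>cball 0 1. f z * g z) \<in> carrier disk_algebra"
    using fg by (intro restrict_in_disk_algebra)
      (auto simp: carrier_disk_algebra intro!: continuous_intros holomorphic_intros)
  ultimately show "f \<oplus>\<^bsub>disk_algebra\<^esub> g \<in> carrier disk_algebra"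
    "f \<otimes>\<^bsub>disk_algebra\<^esub> g \<in> carrier disk_algebra"
    by (simp_all add: disk_algebra_def)
next
  have "(\<lambda>z\<in>cball 0 1. c) \<in> carrier disk_algebra" for c
    by (intro restrict_in_disk_algebra) auto
  then show "\<zero>\<^bsub>disk_algebra\<^esub> \<in> carrier disk_algebra" "\<one>\<^bsub>disk_algebra\<^esub> \<in> carrier disk_algebra"
    by (simp_all add: disk_algebra_def)
next
  fix f assume "f \<in> carrier disk_algebra"
  then have "f \<in> extensional (cball 0 1)"
    by (simp add: carrier_disk_algebra)
  then show "\<zero>\<^bsub>disk_algebra\<^esub> \<oplus>\<^bsub>disk_algebra\<^esub> f = f" "\<one>\<^bsub>disk_algebra\<^esub> \<otimes>\<^bsub>disk_algebra\<^esub> f = f"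
    by (auto simp: disk_algebra_def fun_eq_iff extensional_def)
qed (auto simp: disk_algebra_def fun_eq_iff algebra_simps)

lemma invertible_tuples_subring:
  assumes "subring A disk_algebra"
  shows "invertible_tuples (disk_algebra\<lparr>carrier := A\<rparr>) n =
    {f \<in> {..<n} \<rightarrow>\<^sub>E A. \<exists>x \<in> {..<n} \<rightarrow>\<^sub>E A. \<forall>z\<in>cball 0 1. (\<Sum>j<n. x j z * f j z) = 1}"
proof -
  interpret D: cring disk_algebra by (rule cring_disk_algebra)
  let ?A = "disk_algebra\<lparr>carrier := A\<rparr>"
  interpret A: ring ?A by (rule D.subring_is_ring[OF assms])
  have sum: "(\<Oplus>\<^bsub>?A\<^esub>j\<in>{..<m}. h j) = (\<lambda>z\<in>cball 0 1. \<Sum>j<m. h j z)"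
    if "h \<in> {..<m} \<rightarrow> A" for h and m :: nat
    using that
  proof (induction m)
    case 0
    have "(\<Oplus>\<^bsub>?A\<^esub>j\<in>{..<0}. h j) = \<zero>\<^bsub>?A\<^esub>"
      by (simp only: lessThan_0 A.finsum_empty)
    then show ?case by (simp add: disk_algebra_def)
  next
    case (Suc m)
    have "(\<Oplus>\<^bsub>?A\<^esub>j\<in>insert m {..<m}. h j) = h m \<oplus>\<^bsub>?A\<^esub> (\<Oplus>\<^bsub>?A\<^esub>j\<in>{..<m}. h j)"
      using Suc.prems by (intro A.finsum_insert) auto
    also have "(\<Oplus>\<^bsub>?A\<^esub>j\<in>{..<m}. h j) = (\<lambda>z\<in>cball 0 1. \<Sum>j<m. h j z)"
      using Suc.prems by (intro Suc.IH) auto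
    also have "h m \<oplus>\<^bsub>?A\<^esub> (\<lambda>z\<in>cball 0 1. \<Sum>j<m. h j z) =
        (\<lambda>z\<in>cball 0 1. \<Sum>j<Suc m. h j z)"
      by (simp add: disk_algebra_def restrict_def add.commute cong: if_cong)
    finally show ?case
      by (simp only: lessThan_Suc)
  qed
  have one: "(\<Oplus>\<^bsub>?A\<^esub>j\<in>{..<n}. x j \<otimes>\<^bsub>?A\<^esub> f j) = \<one>\<^bsub>?A\<^esub> \<longleftrightarrow>
      (\<forall>z\<in>cball 0 1. (\<Sum>j<n. x j z * f j z) = 1)"
    if "f \<in> {..<n} \<rightarrow>\<^sub>E A" "x \<in> {..<n} \<rightarrow>\<^sub>E A" for f x
  proof -
    have "(\<lambda>j. x j \<otimes>\<^bsub>?A\<^esub> f j) \<in> {..<n} \<rightarrow> A"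
    proof
      fix j assume "j \<in> {..<n}"
      then have "x j \<in> carrier ?A" "f j \<in> carrier ?A"
        using that by (auto dest: PiE_mem)
      from A.m_closed[OF this] show "x j \<otimes>\<^bsub>?A\<^esub> f j \<in> A"
        by simp
    qed
    from sum[OF this] have "(\<Oplus>\<^bsub>?A\<^esub>j\<in>{..<n}. x j \<otimes>\<^bsub>?A\<^esub> f j) =
        (\<lambda>z\<in>cball 0 1. \<Sum>j<n. (x j \<otimes>\<^bsub>?A\<^esub> f j) z)" .
    also have "\<dots> = (\<lambda>z\<in>cball 0 1. \<Sum>j<n. x j z * f j z)"
      by (simp add: disk_algebra_def restrict_def cong: if_cong)
    finally have "(\<Oplus>\<^bsub>?A\<^esub>j\<in>{..<n}. x j \<otimes>\<^bsub>?A\<^esub> f j) =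
        (\<lambda>z\<in>cball 0 1. \<Sum>j<n. x j z * f j z)" .
    moreover have "\<one>\<^bsub>?A\<^esub> = (\<lambda>z\<in>cball 0 1. 1)"
      by (simp add: disk_algebra_def)
    moreover have "((\<lambda>z\<in>cball 0 1. u z) = (\<lambda>z\<in>cball 0 1. 1)) \<longleftrightarrow>
        (\<forall>z\<in>cball 0 1. u z = 1)" for u :: "complex \<Rightarrow> complex"
      by (metis restrict_apply' restrict_ext)
    ultimately show ?thesis
      by (simp only:)
  qed
  have "tuples ?A n = {..<n} \<rightarrow>\<^sub>E A"
    by (simp add: tuples_def)
  then show ?thesis
    unfolding invertible_tuples_def
    by (simp only:) (intro Collect_cong conj_cong refl bex_cong one)
qed

end

theory Submission
  imports Defs "HOL-Library.Function_Algebras"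
begin

text \<open>There are \<open>f\<^sub>0, f\<^sub>1, \<dots>\<close> in the disk algebra such that the closure of the image of
  \<open>z \<mapsto> (f\<^sub>i z)\<^sub>i\<close> contains the infinite closed polydisc (a lacunary Peano curve).
  Hence a polynomial \<open>P\<close> in finitely many variables is bounded on the polydisc by the supremum of \<open>P(f\<^sub>0, f\<^sub>1, \<dots>)\<close> on the disk, and the closed algebra
  \<open>A\<^sub>n\<close> generated by \<open>f\<^sub>i\<close>, \<open>i < n\<close>, behaves like a polydisc algebra.

  Lower bound: an invertible tuple close to \<open>(f\<^sub>0, \<dots>, f\<^bsub>m-1\<^esub>)\<close> yields polynomials \<open>G\<^sub>j\<close> close to the
  coordinates on the polydisc with \<open>\<Sum> X\<^sub>j G\<^sub>j\<close> close to 1. But \<open>u \<mapsto> u - G u\<close> is a contraction near 0, so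
  the \<open>G\<^sub>j\<close> have a common zero.

  Upper bound: \<open>n + 1\<close> polynomials \<open>p\<^sub>j\<close> in \<open>n\<close> variables satisfy a nontrivial relation \<open>Q(p) = 0\<close>. For
  small \<open>c\<close> with \<open>Q(c) \<noteq> 0\<close>, the expansion \<open>Q(y) - Q(c) = \<Sum> (y\<^sub>j - c\<^sub>j) h\<^sub>j(y)\<close> at \<open>y = p\<close> shows that
  \<open>(p\<^sub>j - c\<^sub>j)\<^sub>j\<close> is invertible.\<close>

section \<open>Polynomial functions\<close>

text \<open>Polynomials are kept as functions of a whole sequence, with variables indexed by
  \<open>I\<close>, so that finitely and infinitely many generators are treated alike and
  composition is plain substitution.\<close>

inductive_set polys :: "nat set \<Rightarrow> ((nat \<Rightarrow> complex) \<Rightarrow> complex) set" for I where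
  const: "(\<lambda>_. c) \<in> polys I"
| var: "i \<in> I \<Longrightarrow> (\<lambda>x. x i) \<in> polys I"
| add: "p \<in> polys I \<Longrightarrow> q \<in> polys I \<Longrightarrow> (\<lambda>x. p x + q x) \<in> polys I"
| mult: "p \<in> polys I \<Longrightarrow> q \<in> polys I \<Longrightarrow> (\<lambda>x. p x * q x) \<in> polys I"

lemma polys_diff:
  assumes "p \<in> polys I" "q \<in> polys I"
  shows "(\<lambda>x. p x - q x) \<in> polys I"
proof -
  have "(\<lambda>x. p x + (\<lambda>_. -1) x * q x) \<in> polys I"
    by (intro polys.intros assms)
  then show ?thesis by simp
qed

lemma polys_sum:
  assumes "\<And>a. a \<in> S \<Longrightarrow> p a \<in> polys I"
  shows "(\<lambda>x. \<Sum>a\<in>S. p a x) \<in> polys I"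
  using assms by (induction S rule: infinite_finite_induct) (auto intro: polys.intros)

lemma polys_prod:
  assumes "\<And>a. a \<in> S \<Longrightarrow> p a \<in> polys I"
  shows "(\<lambda>x. \<Prod>a\<in>S. p a x) \<in> polys I"
  using assms by (induction S rule: infinite_finite_induct) (auto intro: polys.intros)

lemma polys_power:
  assumes "p \<in> polys I"
  shows "(\<lambda>x. p x ^ k) \<in> polys I"
  using polys_prod[of "{..<k}" "\<lambda>_. p" I] assms by simp

lemma polys_compose:
  assumes "q \<in> polys J" and "\<And>j. j \<in> J \<Longrightarrow> p j \<in> polys I"
  shows "(\<lambda>x. q (\<lambda>j. p j x)) \<in> polys I"
  using assms(1) by induction (auto intro: polys.intros assms(2))

text \<open>Coordinatewise convergence is enough even for infinite \<open>I\<close>, since a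
  polynomial involves only finitely many variables.\<close>

lemma tendsto_polys:
  assumes "q \<in> polys I" and "\<And>i. i \<in> I \<Longrightarrow> ((\<lambda>k. u k i) \<longlongrightarrow> v i) F"
  shows "((\<lambda>k. q (u k)) \<longlongrightarrow> q v) F"
  using assms(1) by induction (auto intro!: tendsto_intros assms(2))

text \<open>Reduction to one complex variable, which makes finiteness of roots and later the Schwarz
  lemma available.\<close>

lemma polys_on_line:
  assumes "q \<in> polys I"
  shows "\<exists>r. \<forall>t. q (\<lambda>i. a i + t * b i) = poly r t"
  using assms
proof induction
  case (const c)
  show ?case by (rule exI[of _ "[:c:]"]) simp
next
  case (var i)
  show ?case by (rule exI[of _ "[:a i, b i:]"]) simp
next
  case (add p q)
  then show ?case by (metis poly_add)
next
  case (mult p q)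
  then show ?case by (metis poly_mult)
qed

text \<open>On the line from 0 through \<open>y\<close> the polynomial is nonzero at parameter 1, so
  it has finitely many roots there and all other small parameters serve.\<close>

lemma polys_nonzero_near_0:
  assumes "q \<in> polys I" "q y \<noteq> 0" "finite J" "\<epsilon> > 0"
  obtains c where "q c \<noteq> 0" "\<And>j. j \<in> J \<Longrightarrow> cmod (c j) < \<epsilon>"
proof -
  obtain r where r: "\<And>t. q (\<lambda>i. 0 + t * y i) = poly r t"
    using polys_on_line[OF assms(1), of "\<lambda>_. 0" y] by blast
  have "r \<noteq> 0"
    using r[of 1] assms(2) by auto
  then have "finite {t. poly r t = 0}"
    by (rule poly_roots_finite)
  then have "\<forall>\<^sub>F t in at 0. t \<notin> {t. poly r t = 0}"
    using islimpt_finite islimpt_iff_eventually by blast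
  moreover have "\<forall>\<^sub>F t in at 0. \<forall>j\<in>J. cmod (t * y j) < \<epsilon>"
  proof (intro eventually_ball_finite ballI assms(3))
    fix j
    have "((\<lambda>t. cmod (t * y j)) \<longlongrightarrow> cmod (0 * y j)) (at 0)"
      by (intro tendsto_intros)
    then show "\<forall>\<^sub>F t in at 0. cmod (t * y j) < \<epsilon>"
      using assms(4) by (intro order_tendstoD) auto
  qed
  ultimately have "\<forall>\<^sub>F t in at (0::complex). poly r t \<noteq> 0 \<and> (\<forall>j\<in>J. cmod (t * y j) < \<epsilon>)"
    by eventually_elim auto
  then obtain t where "poly r t \<noteq> 0" "\<forall>j\<in>J. cmod (t * y j) < \<epsilon>"
    using eventually_happens trivial_limit_at by blast
  then show ?thesis
    using that[of "\<lambda>i. 0 + t * y i"] r by auto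
qed

text \<open>Polynomials vanishing at \<open>c\<close> lie in the ideal generated by the
  \<open>y j - c j\<close>. The coefficients are built along the construction of \<open>q\<close>,
  for products by the discrete Leibniz rule.\<close>

lemma polys_diff_expand:
  assumes "q \<in> polys J" "finite J"
  shows "\<exists>h. (\<forall>j\<in>J. h j \<in> polys J) \<and> (\<forall>y. q y - q c = (\<Sum>j\<in>J. (y j - c j) * h j y))"
  using assms(1)
proof induction
  case (const d)
  show ?case by (rule exI[of _ "\<lambda>_ _. 0"]) (auto intro: polys.intros)
next
  case (var i)
  show ?case
    by (rule exI[of _ "\<lambda>j _. if j = i then 1 else 0"])
      (use var assms(2) in \<open>auto intro: polys.intros simp: if_distrib sum.delta' cong: if_cong\<close>)
next
  case (add p q)
  then obtain g h where "\<forall>j\<in>J. g j \<in> polys J" "\<forall>j\<in>J. h j \<in> polys J"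
    and gh: "\<forall>y. p y - p c = (\<Sum>j\<in>J. (y j - c j) * g j y)"
      "\<forall>y. q y - q c = (\<Sum>j\<in>J. (y j - c j) * h j y)"
    by blast
  moreover have "p y + q y - (p c + q c) = (\<Sum>j\<in>J. (y j - c j) * (g j y + h j y))" for y
  proof -
    have "p y + q y - (p c + q c) = (p y - p c) + (q y - q c)"
      by simp
    also have "\<dots> = (\<Sum>j\<in>J. (y j - c j) * (g j y + h j y))"
      unfolding gh[rule_format] sum.distrib[symmetric] by (simp add: algebra_simps)
    finally show ?thesis .
  qed
  ultimately show ?case
    by (intro exI[of _ "\<lambda>j y. g j y + h j y"]) (auto intro: polys.intros)
next
  case (mult p q)
  then obtain g h where "\<forall>j\<in>J. g j \<in> polys J" "\<forall>j\<in>J. h j \<in> polys J"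
    and gh: "\<forall>y. p y - p c = (\<Sum>j\<in>J. (y j - c j) * g j y)"
      "\<forall>y. q y - q c = (\<Sum>j\<in>J. (y j - c j) * h j y)"
    by blast
  moreover have "p y * q y - p c * q c = (\<Sum>j\<in>J. (y j - c j) * (g j y * q y + p c * h j y))" for y
  proof -
    have "p y * q y - p c * q c = (p y - p c) * q y + p c * (q y - q c)"
      by (simp add: algebra_simps)
    also have "\<dots> = (\<Sum>j\<in>J. (y j - c j) * (g j y * q y + p c * h j y))"
      unfolding gh[rule_format] sum_distrib_left sum_distrib_right sum.distrib[symmetric]
      by (simp add: algebra_simps)
    finally show ?thesis .
  qed
  ultimately show ?case
    using mult.hyps
    by (intro exI[of _ "\<lambda>j y. g j y * q y + p c * h j y"])
      (auto intro!: polys.add polys.mult polys.const)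
qed

section \<open>A lacunary Peano curve in the disk algebra\<close>

definition coord :: "nat \<Rightarrow> nat" where
  "coord j = fst (prod_decode j)"

primrec err :: "nat \<Rightarrow> nat \<Rightarrow> real" where
  "err 0 i = 1"
| "err (Suc j) i = (if coord j = i then err j i / 2 else err j i) + (1/2) ^ j"

definition amp :: "nat \<Rightarrow> real" where
  "amp j = err j (coord j) / 2"

primrec freq :: "nat \<Rightarrow> nat" where
  "freq 0 = 1"
| "freq (Suc j) = 64 * 2 ^ j * freq j"

definition lac_term :: "nat \<Rightarrow> nat \<Rightarrow> complex \<Rightarrow> complex" where
  "lac_term i j z = (if coord j = i then of_real (amp j) * z ^ freq j else 0)"

definition lac_curve :: "nat \<Rightarrow> complex \<Rightarrow> complex" where
  "lac_curve i z = (\<Sum>j. lac_term i j z)"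

text \<open>The terms of a single lacunary series are distributed over the coordinates by
  \<^const>\<open>coord\<close>, each coordinate receiving infinitely many. \<open>err j i\<close> bounds the distance from the
  \<open>i\<close>-th target to its partial sum: a term of modulus half the current error, with the phase
  of the remainder, halves the error, and \<open>(1/2) ^ j\<close> absorbs the change of the earlier terms when the
  point moves by \<open>2 * pi / freq j\<close>, which is why \<^const>\<open>freq\<close> grows so fast.\<close>

lemma err_nonneg: "0 \<le> err j i"
  by (induction j) auto

lemma amp_nonneg: "0 \<le> amp j"
  by (simp add: amp_def err_nonneg)

lemma sum_half_powers: "(\<Sum>l<j. (1/2::real) ^ l) \<le> 2"
proof -
  have "(\<Sum>l<j. (1/2::real) ^ l) \<le> (\<Sum>l. (1/2) ^ l)"
    by (intro sum_le_suminf) auto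
  also have "\<dots> = 2"
    by (subst suminf_geometric) auto
  finally show ?thesis .
qed

text \<open>When \<open>coord j = i\<close>, halving \<open>err j i\<close> amounts to subtracting
  \<open>amp j\<close>. As errors are nonnegative, this bounds the amplitude sums of each coordinate
  by 3.\<close>

lemma err_telescope:
  "err j i = 1 + (\<Sum>l<j. (1/2) ^ l) - (\<Sum>l<j. if coord l = i then amp l else 0)"
proof (induction j)
  case (Suc j)
  have "err (Suc j) i = err j i - (if coord j = i then amp j else 0) + (1/2) ^ j"
    by (auto simp: amp_def)
  with Suc show ?case
    by simp
qed simp

lemma amp_le: "amp j \<le> 3 / 2"
proof -
  have "err j i \<le> 3" for i
  proof -
    have "0 \<le> (\<Sum>l<j. if coord l = i then amp l else 0)"
      by (intro sum_nonneg) (auto simp: amp_nonneg)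
    then show ?thesis
      using err_telescope[of j i] sum_half_powers[of j] by linarith
  qed
  then show ?thesis
    by (simp add: amp_def)
qed

lemma summable_amp: "summable (\<lambda>l. if coord l = i then amp l else 0)"
proof (rule summableI_nonneg_bounded)
  show "(\<Sum>l<j. if coord l = i then amp l else 0) \<le> 3" for j
    using err_telescope[of j i] sum_half_powers[of j] err_nonneg[of j i] by linarith
qed (auto simp: amp_nonneg)

text \<open>The error converges because the telescoping sum does. Its limit is twice the limit of the
  amplitudes along the terms of coordinate \<open>i\<close>, which are summable.\<close>

lemma err_tendsto_0: "(\<lambda>j. err j i) \<longlonglongrightarrow> 0"
proof -
  define L where "L = 1 + (\<Sum>l. (1/2::real) ^ l) - (\<Sum>l. if coord l = i then amp l else 0)"
  have L: "(\<lambda>j. err j i) \<longlonglongrightarrow> L"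
    unfolding L_def
    by (subst err_telescope, rule tendsto_diff[OF tendsto_add[OF tendsto_const summable_LIMSEQ] summable_LIMSEQ])
      (simp_all add: summable_amp summable_geometric)
  have sub: "filterlim (\<lambda>k. prod_encode (i, k)) at_top sequentially"
    using filterlim_ident by (rule filterlim_at_top_mono) (auto simp: le_prod_encode_2)
  have "(\<lambda>k. (if coord (prod_encode (i, k)) = i then amp (prod_encode (i, k)) else 0)) \<longlonglongrightarrow> 0"
    by (rule filterlim_compose[OF summable_LIMSEQ_zero[OF summable_amp] sub])
  then have "(\<lambda>k. err (prod_encode (i, k)) i / 2) \<longlonglongrightarrow> 0"
    by (simp add: coord_def amp_def)
  moreover have "(\<lambda>k. err (prod_encode (i, k)) i / 2) \<longlonglongrightarrow> L / 2"
    using filterlim_compose[OF L sub] by (rule tendsto_divide[OF _ tendsto_const]) simp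
  ultimately have "0 = L / 2"
    by (rule LIMSEQ_unique)
  then show ?thesis
    using L by simp
qed

section \<open>Uniform convergence of the series on the closed disk\<close>

lemma norm_lac_term_le:
  assumes "z \<in> cball 0 1"
  shows "cmod (lac_term i j z) \<le> (if coord j = i then amp j else 0)"
  using assms amp_nonneg[of j]
  by (auto simp: lac_term_def norm_mult norm_power intro!: mult_left_le power_le_one)

lemma uniform_limit_lac_curve:
  "uniform_limit (cball 0 1) (\<lambda>n z. \<Sum>j<n. lac_term i j z) (lac_curve i) sequentially"
  unfolding lac_curve_def
  by (rule Weierstrass_m_test[OF norm_lac_term_le summable_amp])

lemma holomorphic_lac_curve:
  "continuous_on (cball 0 1) (lac_curve i)" "lac_curve i holomorphic_on ball 0 1"
proof -
  have "(\<lambda>z. \<Sum>j<n. lac_term i j z) holomorphic_on UNIV" for n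
  proof (intro holomorphic_intros)
    show "(\<lambda>z. lac_term i j z) holomorphic_on UNIV" for j
      by (cases "coord j = i") (auto simp: lac_term_def[abs_def] intro!: holomorphic_intros)
  qed
  then have "continuous_on A (\<lambda>z. \<Sum>j<n. lac_term i j z)"
    "(\<lambda>z. \<Sum>j<n. lac_term i j z) holomorphic_on A" for n A
    by (meson holomorphic_on_imp_continuous_on holomorphic_on_subset subset_UNIV)+
  then have "\<forall>\<^sub>F n in sequentially. continuous_on (cball 0 1) (\<lambda>z. \<Sum>j<n. lac_term i j z)
      \<and> (\<lambda>z. \<Sum>j<n. lac_term i j z) holomorphic_on ball 0 1"
    by simp
  from holomorphic_uniform_limit[OF this uniform_limit_lac_curve trivial_limit_sequentially]
  show "continuous_on (cball 0 1) (lac_curve i)" "lac_curve i holomorphic_on ball 0 1"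
    by blast+
qed

text \<open>The factor \<open>64 * 2 ^ j\<close> in \<open>freq\<close> is made for this induction:
  the frequencies up to \<open>freq j\<close> add up to at most \<open>2 * freq j\<close>, and
  \<open>16 * 2 ^ Suc j * 2 = 64 * 2 ^ j\<close>.\<close>

lemma sum_freq_le: "16 * 2 ^ j * (\<Sum>l<j. freq l) \<le> freq j"
proof (induction j)
  case (Suc j)
  have "(\<Sum>l<j. freq l) \<le> 16 * 2 ^ j * (\<Sum>l<j. freq l)"
    by simp
  then have "(\<Sum>l<j. freq l) \<le> freq j"
    using Suc by linarith
  then have "16 * 2 ^ Suc j * (\<Sum>l<Suc j. freq l) \<le> 16 * 2 ^ Suc j * (2 * freq j)"
    by (intro mult_left_mono) auto
  then show ?case
    by simp
qed simp

text \<open>The \<open>N\<close>-th roots of a unimodular number are spaced by the angle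
  \<open>2 * pi / N\<close>, and a chord is no longer than its arc.\<close>

lemma nearby_root_of_unit:
  fixes z \<zeta> :: complex and N :: nat
  assumes "cmod z = 1" "cmod \<zeta> = 1" "N > 0"
  obtains w where "cmod w = 1" "w ^ N = \<zeta>" "cmod (w - z) \<le> 2 * pi / N"
proof -
  have unit: "cis (Arg x) = x" if "cmod x = 1" for x
  proof -
    have "x \<noteq> 0"
      using that by auto
    then show ?thesis
      using that by (simp add: cis_Arg sgn_eq)
  qed
  note z = unit[OF assms(1)]
  \<comment> \<open>\<open>s\<close> counts the turns by which \<open>Arg \<zeta>\<close> exceeds
    \<open>N * Arg z\<close>. Removing its integer part leaves an angle \<open>t\<close> between
    \<open>Arg z\<close> and \<open>Arg z + 2 * pi / N\<close>.\<close>
  define s where "s = (Arg \<zeta> - N * Arg z) / (2 * pi)"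
  define t where "t = (Arg \<zeta> - 2 * pi * \<lfloor>s\<rfloor>) / N"
  have "t - Arg z = 2 * pi / N * (s - \<lfloor>s\<rfloor>)"
    using assms(3) by (simp add: t_def s_def field_simps)
  moreover have "\<dots> \<le> 2 * pi / N * 1" "0 \<le> 2 * pi / N * (s - \<lfloor>s\<rfloor>)"
    by (intro mult_left_mono mult_nonneg_nonneg; (linarith | simp))+
  ultimately have t: "\<bar>t - Arg z\<bar> \<le> 2 * pi / N"
    by simp
  have "real N * t = Arg \<zeta> - 2 * pi * \<lfloor>s\<rfloor>"
    using assms(3) by (simp add: t_def)
  then have "cis t ^ N = cis (Arg \<zeta> - 2 * pi * \<lfloor>s\<rfloor>)"
    by (simp only: Complex.DeMoivre)
  also have "\<dots> = cis (Arg \<zeta>)"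
    by (simp add: cis_divide[symmetric] cis_multiple_2pi)
  also have "\<dots> = \<zeta>"
    by (rule unit[OF assms(2)])
  finally have "cis t ^ N = \<zeta>" .
  moreover have "cmod (cis t - z) \<le> 2 * pi / N"
  proof -
    have "cis t = cis (Arg z) * cis (t - Arg z)"
      by (simp add: cis_mult)
    then have "cis t - z = z * (cis (t - Arg z) - 1)"
      by (simp only: z right_diff_distrib mult_1_right)
    then have "cmod (cis t - z) = cmod (exp (\<i> * of_real (t - Arg z)) - 1)"
      by (simp only: norm_mult assms(1) mult_1_left cis_conv_exp)
    also have "\<dots> = 2 * \<bar>sin ((t - Arg z) / 2)\<bar>"
      by (rule dist_exp_i_1)
    also have "\<dots> \<le> \<bar>t - Arg z\<bar>"
      using abs_sin_x_le_abs_x[of "(t - Arg z) / 2"] by simp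
    finally show ?thesis
      using t by linarith
  qed
  ultimately show ?thesis
    using that[of "cis t"] by simp
qed

lemma lac_sum_lipschitz:
  assumes "cmod z = 1" "cmod w = 1" "cmod (w - z) \<le> 2 * pi / freq n"
  shows "cmod ((\<Sum>j<n. lac_term i j w) - (\<Sum>j<n. lac_term i j z)) \<le> (1/2) ^ n"
proof -
  have "freq n > 0"
    by (induction n) auto
  have "cmod ((\<Sum>j<n. lac_term i j w) - (\<Sum>j<n. lac_term i j z))
      \<le> (\<Sum>j<n. cmod (lac_term i j w - lac_term i j z))"
    unfolding sum_subtractf[symmetric] by (rule norm_sum)
  also have "\<dots> \<le> (\<Sum>j<n. 3 / 2 * (freq j * (2 * pi / freq n)))"
  proof (rule sum_mono)
    fix j
    have "cmod (w ^ freq j - z ^ freq j) \<le> freq j * cmod (w - z)"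
      using assms by (intro norm_power_diff) auto
    also have "\<dots> \<le> freq j * (2 * pi / freq n)"
      using assms by (intro mult_left_mono) auto
    finally have *: "cmod (w ^ freq j - z ^ freq j) \<le> freq j * (2 * pi / freq n)" .
    have "cmod (lac_term i j w - lac_term i j z) \<le> amp j * cmod (w ^ freq j - z ^ freq j)"
      using amp_nonneg[of j]
      by (auto simp: lac_term_def norm_mult simp flip: right_diff_distrib)
    also have "\<dots> \<le> 3 / 2 * (freq j * (2 * pi / freq n))"
      using amp_le * by (intro mult_mono) auto
    finally show "cmod (lac_term i j w - lac_term i j z) \<le> 3 / 2 * (freq j * (2 * pi / freq n))" .
  qed
  also have "\<dots> = 3 * pi * (\<Sum>j<n. real (freq j)) / freq n"
    by (simp add: sum_distrib_left sum_divide_distrib field_simps)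
  \<comment> \<open>The amplitude bound 3/2 times \<open>2 * pi\<close> gave \<open>3 * pi\<close>,
    which is below the 16 in \<open>sum_freq_le\<close>.\<close>
  also have "\<dots> \<le> 16 * (\<Sum>j<n. real (freq j)) / freq n"
    using pi_less_4 by (intro divide_right_mono mult_right_mono sum_nonneg) auto
  also have "\<dots> \<le> (1/2) ^ n"
  proof -
    have "real (16 * 2 ^ n * (\<Sum>l<n. freq l)) \<le> real (freq n)"
      using sum_freq_le of_nat_le_iff by blast
    then show ?thesis
      using \<open>freq n > 0\<close> by (simp add: field_simps)
  qed
  finally show ?thesis .
qed

text \<open>A greedy choice: step \<open>n\<close> moves the point slightly so that the new term
  takes the phase of the remainder in coordinate \<open>coord n\<close>. One point serves all
  coordinates at once, each paying at most \<open>(1/2) ^ n\<close> for the move.\<close>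

lemma lac_sum_approx:
  assumes "\<And>i. cmod (u i) \<le> 1"
  shows "\<exists>z. cmod z = 1 \<and> (\<forall>i. cmod (u i - (\<Sum>j<n. lac_term i j z)) \<le> err n i)"
proof (induction n)
  case 0
  show ?case
    by (rule exI[of _ 1]) (simp add: assms)
next
  case (Suc n)
  then obtain z where z: "cmod z = 1" "\<And>i. cmod (u i - (\<Sum>j<n. lac_term i j z)) \<le> err n i"
    by blast
  define v where "v = u (coord n) - (\<Sum>j<n. lac_term (coord n) j z)"
  \<comment> \<open>The phase of the remainder. For \<open>v = 0\<close> any unimodular number would
    do.\<close>
  define \<zeta> where "\<zeta> = (if v = 0 then 1 else sgn v)"
  have \<zeta>: "cmod \<zeta> = 1" "v = of_real (cmod v) * \<zeta>"
    by (auto simp: \<zeta>_def norm_sgn) (simp add: sgn_eq)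
  have "cmod (v - of_real (amp n) * \<zeta>) = cmod (of_real (cmod v - amp n) * \<zeta>)"
    using \<zeta>(2) by (simp add: algebra_simps)
  also have "\<dots> = \<bar>cmod v - amp n\<bar>"
    by (simp only: norm_mult norm_of_real \<zeta>(1)) simp
  \<comment> \<open>\<open>cmod v\<close> lies between 0 and \<open>2 * amp n\<close>, so it is
    within \<open>amp n\<close> of the midpoint \<open>amp n\<close>.\<close>
  also have "\<dots> \<le> err n (coord n) / 2"
    using z(2)[of "coord n"] norm_ge_zero[of v] unfolding amp_def v_def by linarith
  finally have v: "cmod (v - of_real (amp n) * \<zeta>) \<le> err n (coord n) / 2" .
  have "freq n > 0"
    by (induction n) auto
  then obtain w where w: "cmod w = 1" "w ^ freq n = \<zeta>" "cmod (w - z) \<le> 2 * pi / freq n"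
    using nearby_root_of_unit[OF z(1) \<zeta>(1)] by blast
  have "cmod (u i - (\<Sum>j<Suc n. lac_term i j w)) \<le> err (Suc n) i" for i
  proof -
    let ?d = "(\<Sum>j<n. lac_term i j w) - (\<Sum>j<n. lac_term i j z)"
    have "u i - (\<Sum>j<Suc n. lac_term i j w)
        = (u i - (\<Sum>j<n. lac_term i j z) - lac_term i n w) - ?d"
      by simp
    also have "cmod \<dots> \<le> cmod (u i - (\<Sum>j<n. lac_term i j z) - lac_term i n w) + cmod ?d"
      by (rule norm_triangle_ineq4)
    also have "\<dots> \<le> (if coord n = i then err n i / 2 else err n i) + (1/2) ^ n"
      using v z(2)[of i] lac_sum_lipschitz[OF z(1) w(1,3)]
      by (intro add_mono) (auto simp: lac_term_def w(2) v_def)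
    finally show ?thesis
      by simp
  qed
  then show ?case
    using w(1) by blast
qed

text \<open>A diagonal argument: the \<open>k\<close>-th point is good for the \<open>k\<close>-th
  partial sums, and uniform convergence allows these to be replaced by the full series at the moving
  point \<open>z k\<close>.\<close>

lemma lac_curve_dense:
  assumes "\<And>i. cmod (u i) \<le> 1"
  obtains z where "\<And>k. z k \<in> cball 0 1" "\<And>i. (\<lambda>k. lac_curve i (z k)) \<longlonglongrightarrow> u i"
proof -
  obtain z where z: "\<And>k. cmod (z k) = 1"
    "\<And>i k. cmod (u i - (\<Sum>j<k. lac_term i j (z k))) \<le> err k i"
    using lac_sum_approx[of u, OF assms] by metis
  have zc: "z k \<in> cball 0 1" for k
    using z(1)[of k] by simp
  have "(\<lambda>k. lac_curve i (z k)) \<longlonglongrightarrow> u i" for i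
  proof -
    have "(\<lambda>k. u i - (\<Sum>j<k. lac_term i j (z k))) \<longlonglongrightarrow> 0"
      using z(2) by (intro Lim_null_comparison[OF _ err_tendsto_0[of i]]) auto
    moreover have "(\<lambda>k. (\<Sum>j<k. lac_term i j (z k)) - lac_curve i (z k)) \<longlonglongrightarrow> 0"
    proof (rule LIMSEQ_I)
      fix r :: real assume "r > 0"
      then have "\<forall>\<^sub>F n in sequentially. \<forall>x\<in>cball 0 1. dist (\<Sum>j<n. lac_term i j x) (lac_curve i x) < r"
        using uniform_limit_lac_curve[of i] by (rule uniform_limitD[rotated])
      then obtain n0 where "\<forall>n\<ge>n0. \<forall>x\<in>cball 0 1. dist (\<Sum>j<n. lac_term i j x) (lac_curve i x) < r"
        unfolding eventually_sequentially by blast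
      then show "\<exists>n0. \<forall>n\<ge>n0. cmod ((\<Sum>j<n. lac_term i j (z n)) - lac_curve i (z n) - 0) < r"
        using zc by (intro exI[of _ n0]) (simp add: dist_norm)
    qed
    ultimately have "(\<lambda>k. u i - ((u i - (\<Sum>j<k. lac_term i j (z k)))
        + ((\<Sum>j<k. lac_term i j (z k)) - lac_curve i (z k)))) \<longlonglongrightarrow> u i - (0 + 0)"
      by (intro tendsto_intros)
    then show ?thesis
      by simp
  qed
  then show ?thesis
    using that zc by blast
qed

section \<open>Algebraic dependence\<close>

text \<open>Spans are taken in the space of all functions, so that the dimension bound applies
  directly to polynomial functions.\<close>

interpretation fun_vs: vector_space "\<lambda>(c::complex) (f::(nat \<Rightarrow> complex) \<Rightarrow> complex) x. c * f x"
  by unfold_locales (auto simp: fun_eq_iff algebra_simps)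

text \<open>The degree is bounded in each variable separately rather than in total, which makes the
  count \<open>(d + 1) ^ N\<close> immediate.\<close>

definition monomials :: "nat \<Rightarrow> nat \<Rightarrow> ((nat \<Rightarrow> complex) \<Rightarrow> complex) set" where
  "monomials N d = (\<lambda>\<beta> x. \<Prod>i<N. x i ^ \<beta> i) ` ({..<N} \<rightarrow>\<^sub>E {..d})"

lemma finite_monomials: "finite (monomials N d)"
  and card_monomials_le: "card (monomials N d) \<le> (d + 1) ^ N"
proof -
  have fin: "finite ({..<N} \<rightarrow>\<^sub>E {..d})"
    by (intro finite_PiE) auto
  then show "finite (monomials N d)"
    by (simp add: monomials_def)
  have "card (monomials N d) \<le> card ({..<N} \<rightarrow>\<^sub>E {..d})"
    unfolding monomials_def by (rule card_image_le[OF fin])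
  then show "card (monomials N d) \<le> (d + 1) ^ N"
    by (simp add: card_PiE)
qed

lemma monomialsI:
  assumes "\<And>i. i < N \<Longrightarrow> \<beta> i \<le> d"
  shows "(\<lambda>x. \<Prod>i<N. x i ^ \<beta> i) \<in> monomials N d"
  unfolding monomials_def
  by (rule image_eqI[of _ _ "restrict \<beta> {..<N}"]) (use assms in auto)

lemma monomials_mono: "d \<le> e \<Longrightarrow> monomials N d \<subseteq> monomials N e"
  unfolding monomials_def by (intro image_mono PiE_mono) auto

lemma monomials_mult:
  assumes "f \<in> monomials N d" "g \<in> monomials N e"
  shows "(\<lambda>x. f x * g x) \<in> monomials N (d + e)"
proof -
  obtain \<beta> \<gamma> where "\<beta> \<in> {..<N} \<rightarrow>\<^sub>E {..d}" "f = (\<lambda>x. \<Prod>i<N. x i ^ \<beta> i)"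
    and "\<gamma> \<in> {..<N} \<rightarrow>\<^sub>E {..e}" "g = (\<lambda>x. \<Prod>i<N. x i ^ \<gamma> i)"
    using assms by (auto simp: monomials_def)
  moreover from this have "(\<lambda>x. \<Prod>i<N. x i ^ (\<beta> i + \<gamma> i)) \<in> monomials N (d + e)"
    by (intro monomialsI add_mono) (auto dest: PiE_mem)
  ultimately show ?thesis
    by (simp add: power_add prod.distrib)
qed

text \<open>Bilinearity reduces the claim to two monomials: the outer induction runs over
  \<open>f\<close>, the inner one over \<open>g\<close> with a monomial of \<open>f\<close>
  fixed.\<close>

lemma span_monomials_mult:
  assumes f: "f \<in> fun_vs.span (monomials N d)" and g: "g \<in> fun_vs.span (monomials N e)"
  shows "(\<lambda>x. f x * g x) \<in> fun_vs.span (monomials N (d + e))"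
  using f
proof (induction rule: fun_vs.span_induct_alt)
  case base
  show ?case
    using fun_vs.span_zero by (simp add: zero_fun_def)
next
  case (step c m f)
  have "(\<lambda>x. m x * g x) \<in> fun_vs.span (monomials N (d + e))"
    using g
  proof (induction rule: fun_vs.span_induct_alt)
    case base
    show ?case
      using fun_vs.span_zero by (simp add: zero_fun_def)
  next
    case (step b n g)
    then have "(\<lambda>x. m x * n x) \<in> fun_vs.span (monomials N (d + e))"
      using \<open>m \<in> monomials N d\<close> by (intro fun_vs.span_base monomials_mult)
    from fun_vs.span_add[OF fun_vs.span_scale[OF this, of b] step.IH] show ?case
      by (simp add: plus_fun_def algebra_simps)
  qed
  from fun_vs.span_add[OF fun_vs.span_scale[OF this, of c] step.IH] show ?case
    by (simp add: plus_fun_def algebra_simps)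
qed

lemma span_monomials_mono:
  "f \<in> fun_vs.span (monomials N d) \<Longrightarrow> d \<le> e \<Longrightarrow> f \<in> fun_vs.span (monomials N e)"
  using fun_vs.span_mono[OF monomials_mono] by blast

lemma one_in_span_monomials: "(\<lambda>_. 1) \<in> fun_vs.span (monomials N d)"
  using monomialsI[of N "\<lambda>_. 0" d] by (auto intro: fun_vs.span_base)

lemma polys_in_span_monomials:
  assumes "p \<in> polys {..<N}"
  shows "\<exists>d. p \<in> fun_vs.span (monomials N d)"
  using assms
proof induction
  case (const c)
  then show ?case
    using fun_vs.span_scale[OF one_in_span_monomials, of c] by auto
next
  case (var i)
  then have eq: "(\<lambda>x. \<Prod>k<N. x k ^ (if k = i then 1 else 0)) = (\<lambda>x. x i)"
    by (simp add: if_distrib prod.delta' cong: if_cong)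
  have "(\<lambda>x. \<Prod>k<N. x k ^ (if k = i then 1 else 0)) \<in> monomials N 1"
    by (rule monomialsI) simp
  then have "(\<lambda>x. x i) \<in> monomials N 1"
    by (simp only: eq)
  from fun_vs.span_base[OF this] show ?case ..
next
  case (add p q)
  then obtain d e where "p \<in> fun_vs.span (monomials N d)" "q \<in> fun_vs.span (monomials N e)"
    by blast
  then have "p + q \<in> fun_vs.span (monomials N (max d e))"
    by (intro fun_vs.span_add) (auto elim: span_monomials_mono)
  then show ?case
    by (auto simp: plus_fun_def)
next
  case (mult p q)
  then show ?case
    using span_monomials_mult by blast
qed

lemma span_monomials_power:
  assumes "p \<in> fun_vs.span (monomials N d)"
  shows "(\<lambda>x. p x ^ k) \<in> fun_vs.span (monomials N (k * d))"
proof (induction k)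
  case (Suc k)
  then show ?case
    using span_monomials_mult[OF assms Suc] by simp
qed (simp add: one_in_span_monomials)

lemma span_monomials_prod:
  assumes "\<And>j. j < m \<Longrightarrow> p j \<in> fun_vs.span (monomials N e)"
  shows "(\<lambda>x. \<Prod>j<m. p j x) \<in> fun_vs.span (monomials N (m * e))"
  using assms
proof (induction m)
  case (Suc m)
  then have "(\<lambda>x. (\<Prod>j<m. p j x) * p m x) \<in> fun_vs.span (monomials N (m * e + e))"
    by (intro span_monomials_mult) auto
  then show ?case
    by (simp add: add.commute)
qed (simp add: one_in_span_monomials)

lemma sum_fun_apply: "(\<Sum>a\<in>A. f a) x = (\<Sum>a\<in>A. f a x)"
  for f :: "'a \<Rightarrow> 'b \<Rightarrow> complex"
  by (induction A rule: infinite_finite_induct) auto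

text \<open>The family is indexed and may repeat itself. Distinct members are too many to be
  independent in the span of \<open>T\<close>; two equal members cancel with coefficients 1 and
  -1.\<close>

lemma linear_relation:
  fixes v :: "nat \<Rightarrow> (nat \<Rightarrow> complex) \<Rightarrow> complex"
  assumes "finite T" "card T < K" and v: "\<And>a. a < K \<Longrightarrow> v a \<in> fun_vs.span T"
  obtains q where "\<exists>a<K. q a \<noteq> 0" "\<And>x. (\<Sum>a<K. q a * v a x) = 0"
proof (cases "inj_on v {..<K}")
  case True
  then have "card (v ` {..<K}) = K"
    by (simp add: card_image)
  then have "fun_vs.dependent (v ` {..<K})"
    using fun_vs.independent_span_bound[of T "v ` {..<K}"] assms by fastforce
  then obtain u where u: "\<exists>w\<in>v ` {..<K}. u w \<noteq> 0" "(\<Sum>w\<in>v ` {..<K}. (\<lambda>x. u w * w x)) = 0"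
    using fun_vs.dependent_finite[of "v ` {..<K}"] by auto
  have "(\<Sum>a<K. u (v a) * v a x) = 0" for x
  proof -
    have "(\<Sum>a<K. u (v a) * v a x) = (\<Sum>w\<in>v ` {..<K}. (\<lambda>x. u w * w x)) x"
      unfolding sum_fun_apply by (simp add: sum.reindex[OF True])
    then show ?thesis
      by (simp add: u(2))
  qed
  then show ?thesis
    using that[of "\<lambda>a. u (v a)"] u(1) by blast
next
  case False
  then obtain a b where ab: "a < K" "b < K" "a \<noteq> b" "v a = v b"
    by (auto simp: inj_on_def)
  define q :: "nat \<Rightarrow> complex" where "q i = (if i = a then 1 else 0) - (if i = b then 1 else 0)" for i
  have "(\<Sum>i<K. q i * v i x) = 0" for x
    using ab by (simp add: q_def left_diff_distrib sum_subtractf if_distrib[of "\<lambda>c. c * _"] cong: if_cong)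
  moreover have "q a \<noteq> 0"
    using ab by (simp add: q_def)
  ultimately show ?thesis
    using that ab(1) by blast
qed

lemma sum_digits:
  fixes M a :: nat
  shows "(\<Sum>j<n. (a div M ^ j mod M) * M ^ j) = a mod M ^ n"
proof (induction n)
  case (Suc n)
  then show ?case
    using mod_mult2_eq[of a "M ^ n" M] by (simp add: mult.commute)
qed simp

text \<open>The \<open>M ^ (N + 1)\<close> products of powers of the \<open>p j\<close> with exponents below \<open>M\<close> lie in a space of
  dimension \<open>O(M ^ N)\<close>. The exponent tuples are the base-\<open>M\<close> digits of a number \<open>a\<close>, so the
  substitution \<open>y j = w ^ M ^ j\<close> turns the \<open>a\<close>-th monomial into \<open>w ^ a\<close> and shows that the relation
  is nontrivial.\<close>

lemma algebraic_relation:
  assumes p: "\<And>j. j < Suc N \<Longrightarrow> p j \<in> polys {..<N}"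
  obtains q y where "q \<in> polys {..<Suc N}" "q y \<noteq> 0" "\<And>x. q (\<lambda>j. p j x) = 0"
proof -
  obtain d where d: "\<And>j. j < Suc N \<Longrightarrow> p j \<in> fun_vs.span (monomials N (d j))"
    using polys_in_span_monomials[OF p] by metis
  define D where "D = (\<Sum>j<Suc N. d j)"
  have pD: "p j \<in> fun_vs.span (monomials N D)" if "j < Suc N" for j
  proof (rule span_monomials_mono[OF d[OF that]])
    show "d j \<le> D"
      unfolding D_def by (rule member_le_sum) (use that in auto)
  qed
  \<comment> \<open>Chosen larger than \<open>(Suc N * D + 1) ^ N\<close>, the factor of
    \<open>M ^ N\<close> in the dimension bound, so that the \<open>M ^ Suc N\<close> products
    outnumber the dimension.\<close>
  define M where "M = (Suc N * D + 1) ^ N + 1"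
  define digit where "digit a j = a div M ^ j mod M" for a j
  define K where "K = M ^ Suc N"
  have "M > 0" by (simp add: M_def)
  have span: "(\<lambda>x. \<Prod>j<Suc N. p j x ^ digit a j) \<in> fun_vs.span (monomials N (Suc N * (M * D)))" for a
  proof (rule span_monomials_prod)
    fix j assume "j < Suc N"
    have "digit a j \<le> M"
      using \<open>M > 0\<close> by (simp add: digit_def less_imp_le)
    then show "(\<lambda>x. p j x ^ digit a j) \<in> fun_vs.span (monomials N (M * D))"
      by (intro span_monomials_mono[OF span_monomials_power[OF pD]] \<open>j < Suc N\<close> mult_right_mono) auto
  qed
  have card: "card (monomials N (Suc N * (M * D))) < K"
  proof -
    have "Suc N * (M * D) + 1 \<le> M * (Suc N * D + 1)"
      using \<open>M > 0\<close> by (simp add: algebra_simps)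
    then have "(Suc N * (M * D) + 1) ^ N \<le> (M * (Suc N * D + 1)) ^ N"
      by (rule power_mono) simp
    also have "\<dots> = M ^ N * (Suc N * D + 1) ^ N"
      by (rule power_mult_distrib)
    also have "\<dots> < M ^ N * M"
      using \<open>M > 0\<close> by (intro mult_strict_left_mono) (simp_all add: M_def)
    also have "\<dots> = K"
      by (simp add: K_def)
    finally show ?thesis
      using card_monomials_le[of N "Suc N * (M * D)"] by linarith
  qed
  obtain c where c: "\<exists>a<K. c a \<noteq> 0"
    "\<And>x. (\<Sum>a<K. c a * (\<Prod>j<Suc N. p j x ^ digit a j)) = 0"
    by (rule linear_relation[where v = "\<lambda>a x. \<Prod>j<Suc N. p j x ^ digit a j",
          OF finite_monomials card span]) (rule that)
  define q where "q = (\<lambda>y :: nat \<Rightarrow> complex. \<Sum>a<K. c a * (\<Prod>j<Suc N. y j ^ digit a j))"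
  have "q \<in> polys {..<Suc N}"
    unfolding q_def
    by (intro polys_sum polys.mult[OF polys.const] polys_prod polys_power polys.var)
  moreover have "\<exists>w. q (\<lambda>j. w ^ M ^ j) \<noteq> 0"
  proof (rule ccontr)
    assume *: "\<nexists>w. q (\<lambda>j. w ^ M ^ j) \<noteq> 0"
    have "(\<Prod>j<Suc N. (w ^ M ^ j) ^ digit a j) = w ^ a" if "a < K" for a and w :: complex
    proof -
      have "(\<Prod>j<Suc N. (w ^ M ^ j) ^ digit a j) = w ^ (\<Sum>j<Suc N. digit a j * M ^ j)"
        by (simp only: power_sum power_mult[symmetric] mult.commute)
      also have "(\<Sum>j<Suc N. digit a j * M ^ j) = a"
        using that by (simp only: digit_def sum_digits K_def mod_less)
      finally show ?thesis .
    qed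
    then have "(\<Sum>a<K. c a * w ^ a) = q (\<lambda>j. w ^ M ^ j)" for w
      by (simp add: q_def)
    moreover have "{..<K} = {..K - 1}"
      using c(1) by auto
    ultimately have "\<forall>w. (\<Sum>a\<le>K - 1. c a * w ^ a) = 0"
      using * by simp
    then show False
      using c(1) polyfun_eq_0[of c "K - 1"] by auto
  qed
  moreover have "q (\<lambda>j. p j x) = 0" for x
    by (simp only: q_def c(2))
  ultimately show ?thesis
    using that by blast
qed

section \<open>Polynomials close to the coordinates\<close>

text \<open>Schwarz lemma on the complex line through \<open>u\<close> and \<open>v\<close>, which stays in the polydisc for
  parameters of modulus at most \<open>1 / (2 * \<delta>)\<close>.\<close>

lemma polys_lipschitz:
  assumes h: "h \<in> polys I" and b: "\<And>x. (\<And>i. cmod (x i) \<le> 1) \<Longrightarrow> cmod (h x) \<le> b" and "b > 0"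
    and u: "\<And>i. cmod (u i) \<le> 1 / 2" and v: "\<And>i. cmod (v i) \<le> 1 / 2"
    and uv: "\<And>i. cmod (u i - v i) \<le> \<delta>" and \<delta>: "0 < \<delta>" "\<delta> < 1 / 2"
  shows "cmod (h u - h v) \<le> 6 * b * \<delta>"
proof -
  obtain r where r: "\<And>t. h (\<lambda>i. v i + t * (u i - v i)) = poly r t"
    using polys_on_line[OF h, of v "\<lambda>i. u i - v i"] by blast
  \<comment> \<open>\<open>s = 2 * \<delta>\<close> corresponds to the point \<open>u\<close> and
    \<open>s = 0\<close> to \<open>v\<close>. Differences are at most \<open>2 * b\<close>; dividing
    by \<open>3 * b\<close> gives the strict bound that the Schwarz lemma requires.\<close>
  define \<phi> where "\<phi> s = (poly r (s / of_real (2 * \<delta>)) - poly r 0) / of_real (3 * b)" for s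
  have bound: "cmod (poly r (s / of_real (2 * \<delta>))) \<le> b" if "cmod s < 1" for s
    unfolding r[symmetric]
  proof (rule b)
    fix i
    have "cmod (s / of_real (2 * \<delta>) * (u i - v i)) = cmod s * cmod (u i - v i) / (2 * \<delta>)"
      using \<delta> by (simp add: norm_mult norm_divide)
    also have "\<dots> \<le> 1 * \<delta> / (2 * \<delta>)"
      using that uv[of i] \<delta> by (intro divide_right_mono mult_mono) auto
    also have "\<dots> = 1 / 2"
      using \<delta> by simp
    finally show "cmod (v i + s / of_real (2 * \<delta>) * (u i - v i)) \<le> 1"
      using v[of i] norm_triangle_ineq[of "v i" "s / of_real (2 * \<delta>) * (u i - v i)"] by linarith
  qed
  have "cmod (\<phi> s) < 1" if "cmod s < 1" for s
  proof -
    have "cmod (poly r (s / of_real (2 * \<delta>)) - poly r 0) \<le> b + b"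
      using bound[OF that] bound[of 0] norm_triangle_ineq4 by (smt (verit) div_0 norm_zero)
    then have "cmod (\<phi> s) \<le> (b + b) / (3 * b)"
      using \<open>b > 0\<close> unfolding \<phi>_def norm_divide norm_of_real
      by (simp add: pos_divide_le_eq)
    also have "\<dots> < 1"
      using \<open>b > 0\<close> by simp
    finally show ?thesis .
  qed
  moreover have \<phi>_0: "\<phi> 0 = 0"
    by (simp add: \<phi>_def)
  moreover have "\<phi> holomorphic_on ball 0 1"
    unfolding \<phi>_def using \<open>b > 0\<close> \<delta> by (intro holomorphic_intros) auto
  moreover have "cmod (of_real (2 * \<delta>) :: complex) < 1"
    using \<delta> unfolding norm_of_real by simp
  ultimately have "cmod (\<phi> (of_real (2 * \<delta>))) \<le> cmod (of_real (2 * \<delta>) :: complex)"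
    using Schwarz_Lemma(1)[of \<phi> "of_real (2 * \<delta>)"] \<phi>_0 by blast
  moreover have "\<phi> (of_real (2 * \<delta>)) = (h u - h v) / of_real (3 * b)"
    using r[of 1] r[of 0] \<delta> by (simp add: \<phi>_def)
  ultimately have "cmod (h u - h v) / (3 * b) \<le> 2 * \<delta>"
    using \<open>b > 0\<close> \<delta> by (simp add: norm_divide norm_mult)
  then show ?thesis
    using \<open>b > 0\<close> by (simp add: field_simps)
qed

text \<open>Common zeros are fixed points of \<open>x - G x\<close>, found as the limit of iterates
  starting at 0. Coordinatewise convergence suffices by \<open>tendsto_polys\<close>, so no norm on
  sequences is involved.\<close>

lemma near_identity_polys_zero:
  assumes G: "\<And>j. j < m \<Longrightarrow> G j \<in> polys I" and I: "{..<m} \<subseteq> I"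
    and near: "\<And>j x. j < m \<Longrightarrow> (\<And>i. cmod (x i) \<le> 1) \<Longrightarrow> cmod (G j x - x j) \<le> 1 / 16"
  obtains x where "\<And>i. cmod (x i) \<le> 1" "\<And>j. j < m \<Longrightarrow> G j x = 0"
proof -
  \<comment> \<open>The value 0 for \<open>j \<ge> m\<close> freezes the remaining coordinates at 0
    and makes \<open>h\<close> a self-map of sequences.\<close>
  define h where "h j = (if j < m then (\<lambda>x. x j - G j x) else (\<lambda>_. 0))" for j
  have h: "h j \<in> polys I" for j
    using G I by (auto simp: h_def intro!: polys_diff polys.var polys.const)
  have h_le: "cmod (h j x) \<le> 1 / 16" if "\<And>i. cmod (x i) \<le> 1" for j x
    using near[of j x] that by (auto simp: h_def norm_minus_commute)
  define u where "u k = ((\<lambda>x j. h j x) ^^ k) (\<lambda>_. 0)" for k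
  have u_0: "u 0 i = 0" and u_Suc: "u (Suc k) i = h i (u k)" for k i
    by (simp_all add: u_def)
  have u_le: "cmod (u k i) \<le> 1 / 16" for k i
  proof (induction k arbitrary: i)
    case (Suc k)
    then have "cmod (u k i) \<le> 1" for i
      by (rule order_trans) simp
    then show ?case
      unfolding u_Suc by (rule h_le)
  qed (simp add: u_0)
  have half: "cmod (u k i) \<le> 1 / 2" for k i
    using u_le[of k i] by linarith
  have diff: "cmod (u (Suc k) i - u k i) \<le> 1 / 4 * (1 / 2) ^ k" for k i
  proof (induction k arbitrary: i)
    case 0
    have "cmod (u (Suc 0) i) \<le> 1 / 4"
      using u_le[of "Suc 0" i] by linarith
    then show ?case
      by (simp add: u_0)
  next
    case (Suc k)
    have "(1 / 2 :: real) ^ k \<le> 1"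
      by (rule power_le_one) auto
    \<comment> \<open>The Lipschitz constant \<open>6 * (1 / 16)\<close> is below 1/2, so successive
      differences at least halve.\<close>
    then have "cmod (h i (u (Suc k)) - h i (u k)) \<le> 6 * (1 / 16) * (1 / 4 * (1 / 2) ^ k)"
      using Suc.IH half by (intro polys_lipschitz[OF h] h_le) auto
    also have "\<dots> \<le> 1 / 4 * (1 / 2) ^ Suc k"
      by simp
    finally show ?case
      unfolding u_Suc .
  qed
  have "\<exists>x. (\<lambda>k. u k i) \<longlonglongrightarrow> x" for i
  proof -
    have "summable (\<lambda>k. u (Suc k) i - u k i)"
    proof (rule summable_comparison_test')
      show "summable (\<lambda>k. 1 / 4 * (1 / 2 :: real) ^ k)"
        by (intro summable_mult summable_geometric) simp
    qed (rule diff)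
    from summable_LIMSEQ[OF this] show ?thesis
      unfolding sum_lessThan_telescope[of "\<lambda>k. u k i"] u_0 by auto
  qed
  then obtain x where x: "\<And>i. (\<lambda>k. u k i) \<longlonglongrightarrow> x i"
    by metis
  have "cmod (x i) \<le> 1 / 16" for i
    by (rule Lim_norm_ubound[OF trivial_limit_sequentially x always_eventually]) (use u_le in blast)
  then have "cmod (x i) \<le> 1" for i
    by (rule order_trans) simp
  moreover have "G j x = 0" if "j < m" for j
  proof -
    have "(\<lambda>k. h j (u k)) \<longlonglongrightarrow> h j x"
      by (rule tendsto_polys[OF h x])
    moreover have "(\<lambda>k. h j (u k)) \<longlonglongrightarrow> x j"
      using LIMSEQ_Suc[OF x[of j]] by (simp only: u_Suc)
    ultimately have "h j x = x j"
      by (rule LIMSEQ_unique)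
    then show ?thesis
      using that by (simp add: h_def)
  qed
  ultimately show ?thesis
    using that by blast
qed

section \<open>Density of invertible tuples\<close>

text \<open>For finite \<open>J\<close>, boxes of balls with one common radius form a neighbourhood
  base of the product topology.\<close>

lemma closure_of_product_mtopology_of:
  assumes "S \<subseteq> J \<rightarrow>\<^sub>E mspace m" "finite J"
  shows "product_topology (\<lambda>_. mtopology_of m) J closure_of S = (J \<rightarrow>\<^sub>E mspace m) \<longleftrightarrow>
    (\<forall>f\<in>J \<rightarrow>\<^sub>E mspace m. \<forall>\<epsilon>>0. \<exists>g\<in>S. \<forall>j\<in>J. mdist m (f j) (g j) < \<epsilon>)"
    (is "?X closure_of S = ?T \<longleftrightarrow> ?R")
proof -
  interpret m: Metric_space "mspace m" "mdist m"
    by simp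
  have top: "topspace ?X = ?T"
    by simp
  have "?X closure_of S \<subseteq> ?T"
    using closure_of_subset_topspace[of ?X S] top by simp
  then have "?X closure_of S = ?T \<longleftrightarrow> (\<forall>f\<in>?T. f \<in> ?X closure_of S)"
    by blast
  also have "\<dots> \<longleftrightarrow> ?R"
  proof (intro ball_cong refl iffI allI impI)
    fix f \<epsilon> assume f: "f \<in> ?T" "f \<in> ?X closure_of S" and "\<epsilon> > (0::real)"
    define V where "V = (\<Pi>\<^sub>E j\<in>J. m.mball (f j) \<epsilon>)"
    have "openin ?X V"
      unfolding V_def using assms(2)
      by (intro openin_PiE_gen[THEN iffD2] disjI2 conjI) (auto simp: mtopology_of_def)
    moreover have "f \<in> V"
      using f(1) \<open>\<epsilon> > 0\<close> by (auto simp: V_def PiE_iff)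
    ultimately obtain g where "g \<in> S" "g \<in> V"
      using f(2) unfolding in_closure_of by blast
    then show "\<exists>g\<in>S. \<forall>j\<in>J. mdist m (f j) (g j) < \<epsilon>"
      by (intro bexI[of _ g]) (auto simp: V_def PiE_iff)
  next
    fix f assume f: "f \<in> ?T" and R: "\<forall>\<epsilon>>0. \<exists>g\<in>S. \<forall>j\<in>J. mdist m (f j) (g j) < \<epsilon>"
    have "\<exists>g\<in>S. g \<in> V" if V: "f \<in> V" "openin ?X V" for V
    proof -
      obtain U where U: "\<forall>j\<in>J. openin (mtopology_of m) (U j)" "f \<in> Pi\<^sub>E J U" "Pi\<^sub>E J U \<subseteq> V"
        using V unfolding openin_product_topology_alt by metis
      have "\<exists>r>0. m.mball (f j) r \<subseteq> U j" if "j \<in> J" for j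
        using U that unfolding mtopology_of_def m.openin_mtopology by (auto simp: PiE_iff)
      then obtain r where r: "\<And>j. j \<in> J \<Longrightarrow> r j > 0 \<and> m.mball (f j) (r j) \<subseteq> U j"
        by metis
      \<comment> \<open>The extra element 1 keeps the minimum defined for empty
        \<open>J\<close>.\<close>
      define \<epsilon> where "\<epsilon> = Min (insert 1 (r ` J))"
      have "\<epsilon> > 0" "\<And>j. j \<in> J \<Longrightarrow> \<epsilon> \<le> r j"
        using assms(2) r by (auto simp: \<epsilon>_def)
      then obtain g where g: "g \<in> S" "\<forall>j\<in>J. mdist m (f j) (g j) < \<epsilon>"
        using R by blast
      have "g j \<in> U j" if "j \<in> J" for j
      proof -
        have "mdist m (f j) (g j) < r j"
          using g(2) \<open>\<And>j. j \<in> J \<Longrightarrow> \<epsilon> \<le> r j\<close> that by fastforce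
        then have "g j \<in> m.mball (f j) (r j)"
          using f g(1) assms(1) that by (auto simp: PiE_iff)
        then show ?thesis
          using r that by blast
      qed
      then have "g \<in> Pi\<^sub>E J U"
        using g(1) assms(1) by (auto simp: PiE_iff)
      then show ?thesis
        using g(1) U(3) by blast
    qed
    then show "f \<in> ?X closure_of S"
      using f top unfolding in_closure_of by blast
  qed
  finally show ?thesis .
qed

lemma bounded_disk_algebra:
  assumes "g \<in> carrier disk_algebra"
  shows "bounded (g ` cball 0 1)"
  using assms
  by (intro compact_imp_bounded compact_continuous_image) (auto simp: carrier_disk_algebra)

lemma mdist_disk_metric_le:
  assumes "f \<in> carrier disk_algebra" "g \<in> carrier disk_algebra"
    and "\<And>z. z \<in> cball 0 1 \<Longrightarrow> cmod (f z - g z) \<le> \<epsilon>"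
  shows "mdist disk_metric f g \<le> \<epsilon>"
  unfolding mdist_disk_metric[OF assms(1,2)] using assms(3) by (intro cSUP_least) auto

lemma norm_diff_le_mdist_disk_metric:
  assumes "f \<in> carrier disk_algebra" "g \<in> carrier disk_algebra" "z \<in> cball 0 1"
  shows "cmod (f z - g z) \<le> mdist disk_metric f g"
  unfolding mdist_disk_metric[OF assms(1,2)]
proof (rule cSUP_upper[OF assms(3)])
  have "compact ((\<lambda>z. cmod (f z - g z)) ` cball 0 1)"
    using assms by (intro compact_continuous_image continuous_intros) (auto simp: carrier_disk_algebra)
  then show "bdd_above ((\<lambda>z. cmod (f z - g z)) ` cball 0 1)"
    by (intro bounded_imp_bdd_above compact_imp_bounded)
qed

text \<open>Density of the invertible tuples with the ring operations and the topology unfolded to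
  pointwise statements.\<close>

definition unimodular_dense :: "(complex \<Rightarrow> complex) set \<Rightarrow> nat \<Rightarrow> bool" where
  "unimodular_dense A n \<longleftrightarrow> (\<forall>f \<in> {..<n} \<rightarrow>\<^sub>E A. \<forall>\<epsilon>>0. \<exists>g \<in> {..<n} \<rightarrow>\<^sub>E A. \<exists>x \<in> {..<n} \<rightarrow>\<^sub>E A.
     (\<forall>z\<in>cball 0 1. (\<Sum>j<n. x j z * g j z) = 1) \<and>
     (\<forall>j<n. \<forall>z\<in>cball 0 1. cmod (f j z - g j z) < \<epsilon>))"

lemma closure_of_invertible_tuples:
  assumes "subring A disk_algebra"
  shows "product_topology (\<lambda>_. mtopology_of (submetric disk_metric A)) {..<n} closure_of
      invertible_tuples (disk_algebra\<lparr>carrier := A\<rparr>) n = tuples (disk_algebra\<lparr>carrier := A\<rparr>) n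
    \<longleftrightarrow> unimodular_dense A n"
proof -
  let ?m = "submetric disk_metric A"
  define S where "S = invertible_tuples (disk_algebra\<lparr>carrier := A\<rparr>) n"
  have A: "A \<subseteq> carrier disk_algebra"
    using assms by (rule subringE(1))
  then have m: "mspace ?m = A"
    by (auto simp: mspace_disk_metric)
  have S: "S = {g \<in> {..<n} \<rightarrow>\<^sub>E A. \<exists>x \<in> {..<n} \<rightarrow>\<^sub>E A. \<forall>z\<in>cball 0 1. (\<Sum>j<n. x j z * g j z) = 1}"
    unfolding S_def by (rule invertible_tuples_subring[OF assms])
  have "tuples (disk_algebra\<lparr>carrier := A\<rparr>) n = ({..<n} \<rightarrow>\<^sub>E mspace ?m)"
    unfolding tuples_def m by simp
  then have "?thesis \<longleftrightarrow> ((\<forall>f\<in>{..<n} \<rightarrow>\<^sub>E A. \<forall>\<epsilon>>0. \<exists>g\<in>S. \<forall>j\<in>{..<n}. mdist ?m (f j) (g j) < \<epsilon>)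
      \<longleftrightarrow> unimodular_dense A n)"
    using closure_of_product_mtopology_of[of S "{..<n}" ?m] m S by (auto simp flip: S_def)
  moreover have "(\<forall>f\<in>{..<n} \<rightarrow>\<^sub>E A. \<forall>\<epsilon>>0. \<exists>g\<in>S. \<forall>j\<in>{..<n}. mdist ?m (f j) (g j) < \<epsilon>)
      \<longleftrightarrow> unimodular_dense A n"
  proof
    assume L: "\<forall>f\<in>{..<n} \<rightarrow>\<^sub>E A. \<forall>\<epsilon>>0. \<exists>g\<in>S. \<forall>j\<in>{..<n}. mdist ?m (f j) (g j) < \<epsilon>"
    show "unimodular_dense A n"
      unfolding unimodular_dense_def
    proof (intro ballI allI impI)
      fix f \<epsilon> assume f: "f \<in> {..<n} \<rightarrow>\<^sub>E A" and "\<epsilon> > (0::real)"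
      then obtain g where g: "g \<in> S" "\<forall>j\<in>{..<n}. mdist disk_metric (f j) (g j) < \<epsilon>"
        using L unfolding mdist_submetric by blast
      have "cmod (f j z - g j z) < \<epsilon>" if "j < n" "z \<in> cball 0 1" for j z
      proof -
        have "f j \<in> carrier disk_algebra" "g j \<in> carrier disk_algebra"
          using f g(1) A that(1) unfolding S by auto
        from norm_diff_le_mdist_disk_metric[OF this that(2)] show ?thesis
          using g(2) that(1) by (auto intro: le_less_trans)
      qed
      then show "\<exists>g\<in>{..<n} \<rightarrow>\<^sub>E A. \<exists>x\<in>{..<n} \<rightarrow>\<^sub>E A.
          (\<forall>z\<in>cball 0 1. (\<Sum>j<n. x j z * g j z) = 1) \<and>
          (\<forall>j<n. \<forall>z\<in>cball 0 1. cmod (f j z - g j z) < \<epsilon>)"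
        using g(1) unfolding S by blast
    qed
  next
    assume R: "unimodular_dense A n"
    show "\<forall>f\<in>{..<n} \<rightarrow>\<^sub>E A. \<forall>\<epsilon>>0. \<exists>g\<in>S. \<forall>j\<in>{..<n}. mdist ?m (f j) (g j) < \<epsilon>"
    proof (intro ballI allI impI)
      fix f \<epsilon> assume f: "f \<in> {..<n} \<rightarrow>\<^sub>E A" and "\<epsilon> > (0::real)"
      \<comment> \<open>A strict pointwise bound gives only a weak bound on the supremum, hence the
        half.\<close>
      then obtain g where g: "g \<in> S" "\<forall>j<n. \<forall>z\<in>cball 0 1. cmod (f j z - g j z) < \<epsilon> / 2"
        using R[unfolded unimodular_dense_def, rule_format, OF f, of "\<epsilon> / 2"] unfolding S by auto
      have "mdist ?m (f j) (g j) < \<epsilon>" if "j \<in> {..<n}" for j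
      proof -
        have "f j \<in> carrier disk_algebra" "g j \<in> carrier disk_algebra"
          using f g(1) A that(1) unfolding S by auto
        then have "mdist disk_metric (f j) (g j) \<le> \<epsilon> / 2"
          using g(2) that by (intro mdist_disk_metric_le less_imp_le) auto
        then show ?thesis
          using \<open>\<epsilon> > 0\<close> by simp
      qed
      then show "\<exists>g\<in>S. \<forall>j\<in>{..<n}. mdist ?m (f j) (g j) < \<epsilon>"
        using g(1) by blast
    qed
  qed
  ultimately show ?thesis
    by (rule iffD2)
qed

lemma subalgebra_tsr_eq:
  assumes "subring A disk_algebra"
  shows "subalgebra_tsr A = Inf {enat n | n. n \<ge> 1 \<and> unimodular_dense A n}"
  unfolding subalgebra_tsr_def tsr_def closure_of_invertible_tuples[OF assms] ..

section \<open>Closed subalgebras generated by a sequence\<close>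

text \<open>The closed unital subalgebra generated by the \<open>f i\<close> with
  \<open>i \<in> I\<close>, when these lie in the disk algebra.\<close>

definition poly_closure :: "(nat \<Rightarrow> complex \<Rightarrow> complex) \<Rightarrow> nat set \<Rightarrow> (complex \<Rightarrow> complex) set" where
  "poly_closure f I = {g \<in> carrier disk_algebra.
     \<forall>\<epsilon>>0. \<exists>q\<in>polys I. \<forall>z\<in>cball 0 1. cmod (g z - q (\<lambda>i. f i z)) < \<epsilon>}"

lemma poly_closure_subset: "poly_closure f I \<subseteq> carrier disk_algebra"
  by (auto simp: poly_closure_def)

lemma poly_closureD:
  assumes "g \<in> poly_closure f I" "\<epsilon> > 0"
  shows "\<exists>q\<in>polys I. \<forall>z\<in>cball 0 1. cmod (g z - q (\<lambda>i. f i z)) < \<epsilon>"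
  using assms by (simp add: poly_closure_def)

lemma uniform_limit_restrict:
  "uniform_limit S u (restrict g S) F \<longleftrightarrow> uniform_limit S u g F"
  by (simp add: uniform_limit_iff)

lemma poly_closureI:
  assumes "g \<in> carrier disk_algebra" "\<And>k. Q k \<in> polys I"
    and "uniform_limit (cball 0 1) (\<lambda>k z. Q k (\<lambda>i. f i z)) g sequentially"
  shows "g \<in> poly_closure f I"
proof -
  have "\<exists>q\<in>polys I. \<forall>z\<in>cball 0 1. cmod (g z - q (\<lambda>i. f i z)) < \<epsilon>" if \<epsilon>: "\<epsilon> > 0" for \<epsilon>
  proof -
    obtain k where "\<forall>z\<in>cball 0 1. dist (Q k (\<lambda>i. f i z)) (g z) < \<epsilon>"
      using uniform_limitD[OF assms(3) \<epsilon>] unfolding eventually_sequentially by blast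
    then show ?thesis
      using assms(2) by (intro bexI[of _ "Q k"]) (auto simp: dist_norm norm_minus_commute)
  qed
  then show ?thesis
    using assms(1) by (simp add: poly_closure_def)
qed

text \<open>The sequential form lets sums and products be handled by the limit theorems for uniform
  convergence.\<close>

lemma poly_closureE:
  assumes "g \<in> poly_closure f I"
  obtains Q where "\<And>k. Q k \<in> polys I"
    "uniform_limit (cball 0 1) (\<lambda>k z. Q k (\<lambda>i. f i z)) g sequentially"
proof -
  have "\<exists>q\<in>polys I. \<forall>z\<in>cball 0 1. cmod (g z - q (\<lambda>i. f i z)) < 1 / real (Suc k)" for k
    using assms unfolding poly_closure_def by (auto simp del: of_nat_Suc)
  then obtain Q where Q: "\<And>k. Q k \<in> polys I"
    "\<And>k z. z \<in> cball 0 1 \<Longrightarrow> cmod (g z - Q k (\<lambda>i. f i z)) < 1 / real (Suc k)"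
    by metis
  have "uniform_limit (cball 0 1) (\<lambda>k z. Q k (\<lambda>i. f i z)) g sequentially"
  proof (rule uniform_limitI)
    fix e :: real assume "e > 0"
    then have "\<forall>\<^sub>F k in sequentially. 1 / real (Suc k) < e"
      by (intro order_tendstoD(2)[OF LIMSEQ_Suc[OF lim_1_over_n]])
    then show "\<forall>\<^sub>F k in sequentially. \<forall>z\<in>cball 0 1. dist (Q k (\<lambda>i. f i z)) (g z) < e"
      by eventually_elim (metis Q(2) dist_commute dist_norm less_trans)
  qed
  then show ?thesis
    using that Q(1) by blast
qed

lemma uniform_limit_sum_mult:
  fixes x :: "'j \<Rightarrow> 'a \<Rightarrow> complex"
  assumes "\<And>j. j \<in> J \<Longrightarrow> uniform_limit S (X j) (x j) F" "\<And>j. j \<in> J \<Longrightarrow> bounded (x j ` S)"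
    and "\<And>j. j \<in> J \<Longrightarrow> uniform_limit S (Y j) (y j) F" "\<And>j. j \<in> J \<Longrightarrow> bounded (y j ` S)"
  shows "uniform_limit S (\<lambda>k z. \<Sum>j\<in>J. X j k z * Y j k z) (\<lambda>z. \<Sum>j\<in>J. x j z * y j z) F"
  using assms
proof (induction J rule: infinite_finite_induct)
  case (insert j J)
  then show ?case
    by (simp, intro uniform_limit_add uniform_lim_mult) auto
qed (auto intro: uniform_limit_const)

locale disk_generators =
  fixes f :: "nat \<Rightarrow> complex \<Rightarrow> complex" and I :: "nat set"
  assumes continuous_generator: "\<And>i. i \<in> I \<Longrightarrow> continuous_on (cball 0 1) (f i)"
    and holomorphic_generator: "\<And>i. i \<in> I \<Longrightarrow> f i holomorphic_on ball 0 1"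
begin

abbreviation A where "A \<equiv> poly_closure f I"

section \<open>Algebraic operations and closedness\<close>

lemma polys_in_closure:
  assumes "q \<in> polys I"
  shows "(\<lambda>z\<in>cball 0 1. q (\<lambda>i. f i z)) \<in> A"
proof -
  have "continuous_on (cball 0 1) (\<lambda>z. q (\<lambda>i. f i z)) \<and> (\<lambda>z. q (\<lambda>i. f i z)) holomorphic_on ball 0 1"
    using assms
    by induction (auto intro!: continuous_intros holomorphic_intros
        continuous_generator holomorphic_generator)
  then have "(\<lambda>z\<in>cball 0 1. q (\<lambda>i. f i z)) \<in> carrier disk_algebra"
    by (intro restrict_in_disk_algebra) auto
  then show ?thesis
    using assms by (auto simp: poly_closure_def intro!: bexI[of _ q])
qed

lemma const_in_closure: "(\<lambda>z\<in>cball 0 1. c) \<in> A"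
  using polys_in_closure[OF polys.const] .

lemma closure_add:
  assumes "g \<in> A" "h \<in> A"
  shows "(\<lambda>z\<in>cball 0 1. g z + h z) \<in> A"
proof -
  obtain P where P: "\<And>k. P k \<in> polys I"
    "uniform_limit (cball 0 1) (\<lambda>k z. P k (\<lambda>i. f i z)) g sequentially"
    by (rule poly_closureE[OF assms(1)]) (rule that)
  obtain Q where Q: "\<And>k. Q k \<in> polys I"
    "uniform_limit (cball 0 1) (\<lambda>k z. Q k (\<lambda>i. f i z)) h sequentially"
    by (rule poly_closureE[OF assms(2)]) (rule that)
  have c: "g \<in> carrier disk_algebra" "h \<in> carrier disk_algebra"
    using assms poly_closure_subset by blast+
  show ?thesis
  proof (rule poly_closureI)
    show "(\<lambda>z\<in>cball 0 1. g z + h z) \<in> carrier disk_algebra"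
      using c by (intro restrict_in_disk_algebra)
        (auto simp: carrier_disk_algebra intro!: continuous_intros holomorphic_intros)
    show "(\<lambda>x. P k x + Q k x) \<in> polys I" for k
      by (intro polys.add P Q)
    show "uniform_limit (cball 0 1) (\<lambda>k z. P k (\<lambda>i. f i z) + Q k (\<lambda>i. f i z))
        (\<lambda>z\<in>cball 0 1. g z + h z) sequentially"
      unfolding uniform_limit_restrict by (rule uniform_limit_add[OF P(2) Q(2)])
  qed
qed

lemma closure_mult:
  assumes "g \<in> A" "h \<in> A"
  shows "(\<lambda>z\<in>cball 0 1. g z * h z) \<in> A"
proof -
  obtain P where P: "\<And>k. P k \<in> polys I"
    "uniform_limit (cball 0 1) (\<lambda>k z. P k (\<lambda>i. f i z)) g sequentially"
    by (rule poly_closureE[OF assms(1)]) (rule that)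
  obtain Q where Q: "\<And>k. Q k \<in> polys I"
    "uniform_limit (cball 0 1) (\<lambda>k z. Q k (\<lambda>i. f i z)) h sequentially"
    by (rule poly_closureE[OF assms(2)]) (rule that)
  have c: "g \<in> carrier disk_algebra" "h \<in> carrier disk_algebra"
    using assms poly_closure_subset by blast+
  show ?thesis
  proof (rule poly_closureI)
    show "(\<lambda>z\<in>cball 0 1. g z * h z) \<in> carrier disk_algebra"
      using c by (intro restrict_in_disk_algebra)
        (auto simp: carrier_disk_algebra intro!: continuous_intros holomorphic_intros)
    show "(\<lambda>x. P k x * Q k x) \<in> polys I" for k
      by (intro polys.mult P Q)
    show "uniform_limit (cball 0 1) (\<lambda>k z. P k (\<lambda>i. f i z) * Q k (\<lambda>i. f i z))
        (\<lambda>z\<in>cball 0 1. g z * h z) sequentially"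
      unfolding uniform_limit_restrict
      by (rule uniform_lim_mult[OF P(2) Q(2) bounded_disk_algebra[OF c(1)] bounded_disk_algebra[OF c(2)]])
  qed
qed

lemma closure_scale:
  assumes "g \<in> A"
  shows "(\<lambda>z\<in>cball 0 1. c * g z) \<in> A"
proof -
  have "(\<lambda>z\<in>cball 0 1. (\<lambda>z\<in>cball 0 1. c) z * g z) \<in> A"
    by (rule closure_mult[OF const_in_closure assms])
  then show ?thesis
    by (simp cong: restrict_cong)
qed

lemma subring_closure: "subring A disk_algebra"
proof -
  interpret D: cring disk_algebra
    by (rule cring_disk_algebra)
  show ?thesis
  proof (rule D.subringI)
    fix g h assume gh: "g \<in> A" "h \<in> A"
    show "g \<oplus>\<^bsub>disk_algebra\<^esub> h \<in> A" "g \<otimes>\<^bsub>disk_algebra\<^esub> h \<in> A"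
      using closure_add[OF gh] closure_mult[OF gh] by (simp_all add: disk_algebra_def)
  next
    fix g assume g: "g \<in> A"
    have neg: "(\<lambda>z\<in>cball 0 1. - 1 * g z) \<in> A"
      by (rule closure_scale[OF g])
    have "\<ominus>\<^bsub>disk_algebra\<^esub> g = (\<lambda>z\<in>cball 0 1. - 1 * g z)"
    proof (rule D.minus_equality)
      show "(\<lambda>z\<in>cball 0 1. - 1 * g z) \<oplus>\<^bsub>disk_algebra\<^esub> g = \<zero>\<^bsub>disk_algebra\<^esub>"
        by (auto simp: disk_algebra_def fun_eq_iff)
    qed (use g neg poly_closure_subset in blast)+
    then show "\<ominus>\<^bsub>disk_algebra\<^esub> g \<in> A"
      using neg by simp
  next
    show "\<one>\<^bsub>disk_algebra\<^esub> \<in> A"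
      using const_in_closure[of 1] by (simp add: disk_algebra_def)
  qed (rule poly_closure_subset)
qed

text \<open>The complement is open: a polynomial within \<open>\<epsilon> / 2\<close> of some
  \<open>h\<close> that is itself within \<open>\<epsilon> / 2\<close> of \<open>g\<close> would
  approximate \<open>g\<close> within \<open>\<epsilon>\<close>.\<close>

lemma closedin_closure: "closedin (mtopology_of disk_metric) A"
proof -
  interpret m: Metric_space "mspace disk_metric" "mdist disk_metric"
    by simp
  have "\<exists>r>0. disjnt A (m.mball g r)" if g: "g \<in> carrier disk_algebra" "g \<notin> A" for g
  proof -
    obtain \<epsilon> where \<epsilon>: "\<epsilon> > 0" "\<And>q. q \<in> polys I \<Longrightarrow> \<not> (\<forall>z\<in>cball 0 1. cmod (g z - q (\<lambda>i. f i z)) < \<epsilon>)"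
      using g unfolding poly_closure_def by blast
    have False if h: "h \<in> A" "h \<in> m.mball g (\<epsilon> / 2)" for h
    proof -
      obtain q where q: "q \<in> polys I" "\<forall>z\<in>cball 0 1. cmod (h z - q (\<lambda>i. f i z)) < \<epsilon> / 2"
        using poly_closureD[OF h(1) half_gt_zero[OF \<epsilon>(1)]] by blast
      have "cmod (g z - q (\<lambda>i. f i z)) < \<epsilon>" if "z \<in> cball 0 1" for z
      proof -
        have "h \<in> carrier disk_algebra"
          using h(1) poly_closure_subset by blast
        from norm_diff_le_mdist_disk_metric[OF g(1) this that] have "cmod (g z - h z) < \<epsilon> / 2"
          using h(2) by simp
        then show ?thesis
          using q(2)[rule_format, OF that] norm_triangle_ineq[of "g z - h z" "h z - q (\<lambda>i. f i z)"]
          by simp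
      qed
      then show False
        using \<epsilon>(2)[OF q(1)] by blast
    qed
    then show ?thesis
      using \<epsilon>(1) by (intro exI[of _ "\<epsilon> / 2"]) (auto simp: disjnt_iff)
  qed
  then show ?thesis
    unfolding mtopology_of_def m.closedin_metric
    using poly_closure_subset by (auto simp: mspace_disk_metric)
qed

lemma closed_unital_subalgebra_closure: "closed_unital_subalgebra A"
  unfolding closed_unital_subalgebra_def
  using subring_closure closedin_closure closure_scale by blast

text \<open>Half of \<open>\<epsilon>\<close> is spent on replacing the tuple by polynomials, the
  other half on the shift by \<open>c\<close>.\<close>

lemma unimodular_dense_Suc:
  assumes I: "I = {..<N}"
  shows "unimodular_dense A (Suc N)"
  unfolding unimodular_dense_def
proof (intro ballI allI impI)
  fix g and \<epsilon> :: real
  assume g: "g \<in> {..<Suc N} \<rightarrow>\<^sub>E A" and "\<epsilon> > 0"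
  have "\<forall>j\<in>{..<Suc N}. \<exists>q\<in>polys I. \<forall>z\<in>cball 0 1. cmod (g j z - q (\<lambda>i. f i z)) < \<epsilon> / 2"
  proof
    fix j assume "j \<in> {..<Suc N}"
    with g have "g j \<in> A"
      by (rule PiE_mem)
    then show "\<exists>q\<in>polys I. \<forall>z\<in>cball 0 1. cmod (g j z - q (\<lambda>i. f i z)) < \<epsilon> / 2"
      by (rule poly_closureD) (use \<open>\<epsilon> > 0\<close> in simp)
  qed
  then obtain p where p: "\<And>j. j < Suc N \<Longrightarrow> p j \<in> polys I"
    "\<And>j z. j < Suc N \<Longrightarrow> z \<in> cball 0 1 \<Longrightarrow> cmod (g j z - p j (\<lambda>i. f i z)) < \<epsilon> / 2"
    unfolding bchoice_iff Bex_def by blast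
  obtain q y where q: "q \<in> polys {..<Suc N}" "q y \<noteq> 0" "\<And>x. q (\<lambda>j. p j x) = 0"
    by (rule algebraic_relation[of N p, OF p(1)[unfolded I]]) (assumption, rule that)
  obtain c where c: "q c \<noteq> 0" "\<And>j. j \<in> {..<Suc N} \<Longrightarrow> cmod (c j) < \<epsilon> / 2"
    by (rule polys_nonzero_near_0[OF q(1,2) finite_lessThan half_gt_zero[OF \<open>\<epsilon> > 0\<close>]]) (rule that)
  obtain h where h': "\<forall>j\<in>{..<Suc N}. h j \<in> polys {..<Suc N}"
    and h: "\<And>y. q y - q c = (\<Sum>j<Suc N. (y j - c j) * h j y)"
    using polys_diff_expand[OF q(1) finite_lessThan, of c] by (elim exE conjE) (rule that, simp_all only:)
  define G where "G = (\<lambda>j\<in>{..<Suc N}. \<lambda>z\<in>cball 0 1. p j (\<lambda>i. f i z) - c j)"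
  \<comment> \<open>Since \<open>q\<close> vanishes at \<open>p\<close>, the expansion there has
    left side \<open>- q c\<close>; dividing by it turns the \<open>h j\<close> into Bezout
    coefficients.\<close>
  define X where "X = (\<lambda>j\<in>{..<Suc N}. \<lambda>z\<in>cball 0 1. - 1 / q c * h j (\<lambda>l. p l (\<lambda>i. f i z)))"
  have GA: "G \<in> {..<Suc N} \<rightarrow>\<^sub>E A"
  proof
    fix j assume "j \<in> {..<Suc N}"
    then have "(\<lambda>x. p j x - c j) \<in> polys I"
      using p(1) by (intro polys_diff polys.const) auto
    from polys_in_closure[OF this] show "G j \<in> A"
      using \<open>j \<in> {..<Suc N}\<close> by (simp add: G_def)
  qed (simp add: G_def)
  have XA: "X \<in> {..<Suc N} \<rightarrow>\<^sub>E A"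
  proof
    fix j assume "j \<in> {..<Suc N}"
    then have "h j \<in> polys {..<Suc N}"
      using h' by blast
    then have "(\<lambda>x. h j (\<lambda>l. p l x)) \<in> polys I"
      by (rule polys_compose[of _ _ p]) (simp add: p(1))
    then have "(\<lambda>x. - 1 / q c * h j (\<lambda>l. p l x)) \<in> polys I"
      by (rule polys.mult[OF polys.const])
    from polys_in_closure[OF this] show "X j \<in> A"
      using \<open>j \<in> {..<Suc N}\<close> by (simp add: X_def)
  qed (simp add: X_def)
  have one: "(\<Sum>j<Suc N. X j z * G j z) = 1" if "z \<in> cball 0 1" for z
  proof -
    let ?y = "\<lambda>j. p j (\<lambda>i. f i z)"
    have "(\<Sum>j<Suc N. X j z * G j z) = (\<Sum>j<Suc N. - 1 / q c * ((?y j - c j) * h j ?y))"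
      using that by (intro sum.cong) (auto simp: X_def G_def)
    also have "\<dots> = - 1 / q c * (q ?y - q c)"
      unfolding h sum_distrib_left ..
    also have "\<dots> = 1"
      using c(1) by (simp add: q(3))
    finally show ?thesis .
  qed
  have close: "cmod (g j z - G j z) < \<epsilon>" if "j < Suc N" "z \<in> cball 0 1" for j z
  proof -
    have eq: "g j z - G j z = (g j z - p j (\<lambda>i. f i z)) + c j"
      using that by (simp add: G_def)
    have "cmod (c j) < \<epsilon> / 2"
      using c(2) that(1) by simp
    then show ?thesis
      unfolding eq
      using norm_triangle_ineq[of "g j z - p j (\<lambda>i. f i z)" "c j"] p(2)[OF that] by linarith
  qed
  show "\<exists>G\<in>{..<Suc N} \<rightarrow>\<^sub>E A. \<exists>x\<in>{..<Suc N} \<rightarrow>\<^sub>E A.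
      (\<forall>z\<in>cball 0 1. (\<Sum>j<Suc N. x j z * G j z) = 1) \<and>
      (\<forall>j<Suc N. \<forall>z\<in>cball 0 1. cmod (g j z - G j z) < \<epsilon>)"
    by (rule bexI[OF bexI[OF _ XA] GA]) (use one close in blast)
qed

text \<open>The bound holds on the image of the disk, whose coordinatewise limits fill the polydisc,
  and it survives such limits.\<close>

lemma polys_bound_transfer:
  assumes dense: "\<And>u. (\<And>i. cmod (u i) \<le> 1) \<Longrightarrow>
      \<exists>z. (\<forall>k. z k \<in> cball 0 1) \<and> (\<forall>i\<in>I. (\<lambda>k. f i (z k)) \<longlonglongrightarrow> u i)"
    and q: "q \<in> polys I" and le: "\<And>z. z \<in> cball 0 1 \<Longrightarrow> cmod (q (\<lambda>i. f i z)) \<le> b"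
    and u: "\<And>i. cmod (u i) \<le> 1"
  shows "cmod (q u) \<le> b"
proof -
  obtain z where z: "\<And>k. z k \<in> cball 0 1" "\<And>i. i \<in> I \<Longrightarrow> (\<lambda>k. f i (z k)) \<longlonglongrightarrow> u i"
    using dense[of u, OF u] by blast
  have "(\<lambda>k. q (\<lambda>i. f i (z k))) \<longlonglongrightarrow> q u"
    using q z(2) by (rule tendsto_polys)
  then show ?thesis
    by (rule Lim_norm_ubound[OF trivial_limit_sequentially _ always_eventually]) (use le z(1) in blast)
qed

lemma not_unimodular_dense:
  assumes dense: "\<And>u. (\<And>i. cmod (u i) \<le> 1) \<Longrightarrow>
      \<exists>z. (\<forall>k. z k \<in> cball 0 1) \<and> (\<forall>i\<in>I. (\<lambda>k. f i (z k)) \<longlonglongrightarrow> u i)"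
    and m: "{..<m} \<subseteq> I"
  shows "\<not> unimodular_dense A m"
proof
  assume U: "unimodular_dense A m"
  define F where "F = (\<lambda>j\<in>{..<m}. \<lambda>z\<in>cball 0 1. f j z)"
  have "F \<in> {..<m} \<rightarrow>\<^sub>E A"
    using m polys_in_closure[OF polys.var] by (auto simp: F_def)
  from U[unfolded unimodular_dense_def, rule_format, OF this, of "1 / 32"]
  obtain g x where gA: "g \<in> {..<m} \<rightarrow>\<^sub>E A" and xA: "x \<in> {..<m} \<rightarrow>\<^sub>E A"
    and one: "\<And>z. z \<in> cball 0 1 \<Longrightarrow> (\<Sum>j<m. x j z * g j z) = 1"
    and close: "\<And>j z. j < m \<Longrightarrow> z \<in> cball 0 1 \<Longrightarrow> cmod (F j z - g j z) < 1 / 32"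
    by auto
  \<comment> \<open>Elements of \<open>A\<close> are functions on the disk only. Both
    \<open>g\<close> and \<open>x\<close> are replaced by polynomials, which can be evaluated at
    every point of the polydisc.\<close>
  have "\<forall>j\<in>{..<m}. \<exists>Q. (\<forall>k. Q k \<in> polys I) \<and>
      uniform_limit (cball 0 1) (\<lambda>k z. Q k (\<lambda>i. f i z)) (g j) sequentially"
    using gA by (auto elim!: poly_closureE dest: PiE_mem)
  then obtain G where G: "\<And>j k. j < m \<Longrightarrow> G j k \<in> polys I"
    "\<And>j. j < m \<Longrightarrow> uniform_limit (cball 0 1) (\<lambda>k z. G j k (\<lambda>i. f i z)) (g j) sequentially"
    by (metis lessThan_iff)
  have "\<forall>j\<in>{..<m}. \<exists>Q. (\<forall>k. Q k \<in> polys I) \<and>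
      uniform_limit (cball 0 1) (\<lambda>k z. Q k (\<lambda>i. f i z)) (x j) sequentially"
    using xA by (auto elim!: poly_closureE dest: PiE_mem)
  then obtain X where X: "\<And>j k. j < m \<Longrightarrow> X j k \<in> polys I"
    "\<And>j. j < m \<Longrightarrow> uniform_limit (cball 0 1) (\<lambda>k z. X j k (\<lambda>i. f i z)) (x j) sequentially"
    by (metis lessThan_iff)
  have bdd: "bounded (x j ` cball 0 1)" "bounded (g j ` cball 0 1)" if "j < m" for j
    using that gA xA poly_closure_subset by (auto intro!: bounded_disk_algebra dest!: PiE_mem)
  have "uniform_limit (cball 0 1)
      (\<lambda>k z. \<Sum>j<m. X j k (\<lambda>i. f i z) * G j k (\<lambda>i. f i z)) (\<lambda>z. \<Sum>j<m. x j z * g j z) sequentially"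
    using X(2) G(2) bdd by (intro uniform_limit_sum_mult) auto
  then have "\<forall>\<^sub>F k in sequentially. \<forall>z\<in>cball 0 1.
      dist (\<Sum>j<m. X j k (\<lambda>i. f i z) * G j k (\<lambda>i. f i z)) (\<Sum>j<m. x j z * g j z) < 1 / 2"
    by (rule uniform_limitD) simp
  moreover have "\<forall>\<^sub>F k in sequentially. \<forall>j\<in>{..<m}. \<forall>z\<in>cball 0 1.
      dist (G j k (\<lambda>i. f i z)) (g j z) < 1 / 32"
    using G(2) by (intro eventually_ball_finite ballI uniform_limitD) auto
  ultimately have "\<forall>\<^sub>F k in sequentially.
      (\<forall>z\<in>cball 0 1. dist (\<Sum>j<m. X j k (\<lambda>i. f i z) * G j k (\<lambda>i. f i z)) (\<Sum>j<m. x j z * g j z) < 1 / 2) \<and>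
      (\<forall>j\<in>{..<m}. \<forall>z\<in>cball 0 1. dist (G j k (\<lambda>i. f i z)) (g j z) < 1 / 32)"
    by (rule eventually_conj)
  from eventually_happens'[OF sequentially_bot this] obtain k where
    k: "\<forall>z\<in>cball 0 1. dist (\<Sum>j<m. X j k (\<lambda>i. f i z) * G j k (\<lambda>i. f i z)) (\<Sum>j<m. x j z * g j z) < 1 / 2"
      "\<forall>j\<in>{..<m}. \<forall>z\<in>cball 0 1. dist (G j k (\<lambda>i. f i z)) (g j z) < 1 / 32"
    by (elim exE conjE) (rule that)
  have k1: "cmod ((\<Sum>j<m. X j k (\<lambda>i. f i z) * G j k (\<lambda>i. f i z)) - 1) < 1 / 2"
    if "z \<in> cball 0 1" for z
    using k(1)[rule_format, OF that] unfolding one[OF that] dist_norm .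
  have k2: "cmod (G j k (\<lambda>i. f i z) - g j z) < 1 / 32" if "j < m" "z \<in> cball 0 1" for j z
    using k(2)[rule_format, of j z] that unfolding dist_norm by simp
  \<comment> \<open>Two errors of 1/32, from \<open>f j\<close> to \<open>g j\<close> and from
    \<open>g j\<close> to the polynomial, make up the 1/16 that the fixed-point argument
    allows.\<close>
  have near: "cmod (G j k u - u j) \<le> 1 / 16" if "j < m" and u: "\<And>i. cmod (u i) \<le> 1" for j u
  proof (rule polys_bound_transfer[OF dense _ _ u])
    show "(\<lambda>u. G j k u - u j) \<in> polys I"
      using G(1) m that(1) by (intro polys_diff polys.var) auto
    show "cmod (G j k (\<lambda>i. f i z) - f j z) \<le> 1 / 16" if "z \<in> cball 0 1" for z
    proof -
      have "cmod (f j z - g j z) < 1 / 32"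
        using close[OF \<open>j < m\<close> that] \<open>j < m\<close> that by (simp add: F_def)
      then show ?thesis
        using k2[OF \<open>j < m\<close> that] norm_triangle_ineq4[of "G j k (\<lambda>i. f i z) - g j z" "f j z - g j z"]
        by simp
    qed
  qed auto
  obtain u where u: "\<And>i. cmod (u i) \<le> 1" "\<And>j. j < m \<Longrightarrow> G j k u = 0"
  proof (rule near_identity_polys_zero)
    show "G j k \<in> polys I" if "j < m" for j
      using that by (rule G(1))
    show "cmod (G j k u - u j) \<le> 1 / 16" if "j < m" "\<And>i. cmod (u i) \<le> 1" for j u
      using that by (rule near)
  qed (use m in auto)
  \<comment> \<open>At the common zero \<open>u\<close> the sum is 0, so this estimate reads 1 \<le>
    1/2.\<close>
  have "cmod ((\<Sum>j<m. X j k u * G j k u) - 1) \<le> 1 / 2"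
  proof (rule polys_bound_transfer[OF dense _ _ u(1)])
    show "(\<lambda>u. (\<Sum>j<m. X j k u * G j k u) - 1) \<in> polys I"
      using X(1) G(1) by (intro polys_diff polys_sum polys.mult polys.const) auto
  qed (use k1 in \<open>auto intro: less_imp_le\<close>)
  then show False
    using u(2) by simp
qed

end

theorem corollary3p2:
  fixes n :: enat
  assumes "n \<ge> 1"
  shows "\<exists>A. closed_unital_subalgebra A \<and> subalgebra_tsr A = n + 1"
proof -
  \<comment> \<open>This covers both cases: the first \<open>N\<close> indices for
    \<open>n = enat N\<close>, all indices for infinite \<open>n\<close>.\<close>
  define I where "I = {i. enat i < n}"
  interpret disk_generators lac_curve I
    by unfold_locales (rule holomorphic_lac_curve)+
  have low: "\<not> unimodular_dense A m" if "enat m \<le> n" for m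
  proof (rule not_unimodular_dense)
    show "\<exists>z. (\<forall>k. z k \<in> cball 0 1) \<and> (\<forall>i\<in>I. (\<lambda>k. lac_curve i (z k)) \<longlonglongrightarrow> u i)"
      if "\<And>i. cmod (u i) \<le> 1" for u
      using lac_curve_dense[of u, OF that] by metis
    show "{..<m} \<subseteq> I"
      using that by (auto simp: I_def intro: less_le_trans[of _ "enat m"])
  qed
  have "subalgebra_tsr A = n + 1"
  proof (cases n)
    case (enat N)
    then have "I = {..<N}"
      by (auto simp: I_def)
    then have "unimodular_dense A (Suc N)"
      by (rule unimodular_dense_Suc)
    then have "Inf {enat k | k. k \<ge> 1 \<and> unimodular_dense A k} = enat (Suc N)"
    proof (intro antisym Inf_lower Inf_greatest)
      fix e assume "e \<in> {enat k | k. k \<ge> 1 \<and> unimodular_dense A k}"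
      then obtain k where "e = enat k" "unimodular_dense A k"
        by blast
      then show "enat (Suc N) \<le> e"
        using low[of k] enat by (cases "k \<le> N") auto
    qed auto
    then show ?thesis
      unfolding subalgebra_tsr_eq[OF subring_closure] enat by (simp add: one_enat_def)
  next
    case infinity
    \<comment> \<open>Every finite length lies below \<open>n\<close> and is excluded by
      \<open>low\<close>, so the infimum is over the empty set.\<close>
    then have empty: "{enat k | k. k \<ge> 1 \<and> unimodular_dense A k} = {}"
      using low by auto
    show ?thesis
      unfolding subalgebra_tsr_eq[OF subring_closure] empty infinity by (simp add: top_enat_def)
  qed
  then show ?thesis
    using closed_unital_subalgebra_closure by blast
qed

end
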